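(* Let $Q$ be a compact Hausdorff space, let $F=\mathbb{C}$, $\mathbb{R}$ or $\mathbb{H}$ (the quaternions), and let $C(Q,\mathcal{N}_n(F))$ be the algebra of all continuous maps from $Q$ to the C$^*$-algebra $\mathcal{N}_n(F)$ of infinite matrices over $F$. Let $\bigtriangleup : C(Q,\mathcal{N}_n(F)) \to C(Q,\mathcal{N}_n(F))$ be a 2-local derivation (not assumed linear). Then $\bigtriangleup$ is a derivation.
   Context: For $i,j\in\mathbb{N}=\{1,2,\dots\}$ let $e_{ij}$ be the infinite $\mathbb{N}\times\mathbb{N}$ matrix with $1$ in position $(i,j)$ and $0$ elsewhere. $\mathcal{N}_n(F)=\sum_{ij}^o Fe_{ij}$ is the set of all infinite matrices $\{\lambda^{ij}e_{ij}\}_{i,j\in\mathbb{N}}$ with $\lambda^{ij}\in F$ such that for every $\varepsilon>0$ there exists $n_0\in\mathbb{N}$ such that for all integers $p\ge m\ge n_0$ $$\Bigl\Vert \sum_{i=m}^{p}\Bigl[\sum_{k=1}^{i-1}(\lambda^{ki}e_{ki}+\lambda^{ik}e_{ik})+\lambda^{ii}e_{ii}\Bigr]\Bigr\Vert<\varepsilon ,$$ where $\Vert\cdot\Vert$ is the operator norm of a (finite) matrix over $F$. With entrywise linear operations, the usual matrix product $\{\lambda^{ij}e_{ij}\}\{\mu^{ij}e_{ij}\}=\{\sum_{\xi}\lambda^{i\xi}\mu^{\xi j}e_{ij}\}$, the conjugate-transpose involution, and the norm equal to the supremum of the operator norms of finite square submatrices, $\mathcal{N}_n(F)$ is a C$^*$-algebra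 (a complex one if $F=\mathbb{C}$, a real one if $F=\mathbb{R}$ or $\mathbb{H}$). Continuity of maps $Q\to\mathcal{N}_n(F)$ is with respect to the norm, and $C(Q,\mathcal{N}_n(F))$ has pointwise operations. It is regarded as a complex algebra if $F=\mathbb{C}$ and as a real algebra if $F=\mathbb{R}$ or $\mathbb{H}$. A derivation on an associative algebra $A$ is a linear map $D:A\to A$ (complex-linear if $F=\mathbb{C}$, real-linear if $F=\mathbb{R}$ or $\mathbb{H}$) with $D(xy)=D(x)y+xD(y)$ for all $x,y\in A$. A 2-local derivation on $A$ is a map $\bigtriangleup:A\to A$ (not linear in general) such that for every two elements $x,y\in A$ there exists a derivation $D_{x,y}:A\to A$ with $\bigtriangleup(x)=D_{x,y}(x)$ and $\bigtriangleup(y)=D_{x,y}(y)$. *)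

theory Defs
  imports "HOL-Analysis.Analysis" "HOL-Library.Function_Algebras"
begin

section \<open>Quaternions\<close>

datatype quat = Quat (qre: real) (qi: real) (qj: real) (qk: real)

lemma quat_eq_iff: "x = y \<longleftrightarrow> qre x = qre y \<and> qi x = qi y \<and> qj x = qj y \<and> qk x = qk y"
  by (cases x; cases y) auto

lemma quat_eqI: "qre x = qre y \<Longrightarrow> qi x = qi y \<Longrightarrow> qj x = qj y \<Longrightarrow> qk x = qk y \<Longrightarrow> x = y"
  by (simp add: quat_eq_iff)

instantiation quat :: ab_group_add
begin

definition "0 = Quat 0 0 0 0"
definition "x + y = Quat (qre x + qre y) (qi x + qi y) (qj x + qj y) (qk x + qk y)"
definition "x - y = Quat (qre x - qre y) (qi x - qi y) (qj x - qj y) (qk x - qk y)"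
definition "- x = Quat (- qre x) (- qi x) (- qj x) (- qk x)"

instance
  by standard (simp_all add: quat_eq_iff zero_quat_def plus_quat_def minus_quat_def uminus_quat_def)

end

instantiation quat :: ring_1
begin

definition "1 = Quat 1 0 0 0"
definition "x * y = Quat
  (qre x * qre y - qi x * qi y - qj x * qj y - qk x * qk y)
  (qre x * qi y + qi x * qre y + qj x * qk y - qk x * qj y)
  (qre x * qj y - qi x * qk y + qj x * qre y + qk x * qi y)
  (qre x * qk y + qi x * qj y - qj x * qi y + qk x * qre y)"

instance
  by standard (simp_all add: quat_eq_iff zero_quat_def one_quat_def plus_quat_def times_quat_def algebra_simps)

end

lemma quat_sel [simp]:
  "qre 0 = 0" "qi 0 = 0" "qj 0 = 0" "qk 0 = 0"
  "qre 1 = 1" "qi 1 = 0" "qj 1 = 0" "qk 1 = 0"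
  "qre (x + y) = qre x + qre y" "qi (x + y) = qi x + qi y"
  "qj (x + y) = qj x + qj y" "qk (x + y) = qk x + qk y"
  "qre (x - y) = qre x - qre y" "qi (x - y) = qi x - qi y"
  "qj (x - y) = qj x - qj y" "qk (x - y) = qk x - qk y"
  "qre (- x) = - qre x" "qi (- x) = - qi x" "qj (- x) = - qj x" "qk (- x) = - qk x"
  by (simp_all add: zero_quat_def one_quat_def plus_quat_def minus_quat_def uminus_quat_def)

instantiation quat :: real_algebra_1
begin

definition "scaleR r x = Quat (r * qre x) (r * qi x) (r * qj x) (r * qk x)"

instance
  by standard (simp_all add: quat_eq_iff times_quat_def scaleR_quat_def algebra_simps)

end

lemma quat_scaleR_sel [simp]:
  "qre (r *\<^sub>R x) = r * qre x" "qi (r *\<^sub>R x) = r * qi x"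
  "qj (r *\<^sub>R x) = r * qj x" "qk (r *\<^sub>R x) = r * qk x"
  by (simp_all add: scaleR_quat_def)

definition quat_norm2 :: "quat \<Rightarrow> real" where
  "quat_norm2 x = (qre x)\<^sup>2 + (qi x)\<^sup>2 + (qj x)\<^sup>2 + (qk x)\<^sup>2"

lemma quat_norm2_nonneg: "0 \<le> quat_norm2 x"
  by (simp add: quat_norm2_def)

lemma quat_norm2_eq_0: "quat_norm2 x = 0 \<longleftrightarrow> x = 0"
  by (simp add: quat_norm2_def quat_eq_iff add_nonneg_eq_0_iff)

lemma quat_norm2_mult: "quat_norm2 (x * y) = quat_norm2 x * quat_norm2 y"
  by (simp add: quat_norm2_def times_quat_def power2_eq_square algebra_simps)

instantiation quat :: real_normed_div_algebra
begin

definition "norm x = sqrt (quat_norm2 x)"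
definition "sgn x = x /\<^sub>R norm (x :: quat)"
definition "dist x y = norm (x - y :: quat)"
definition
  "(uniformity :: (quat \<times> quat) filter) = (INF e\<in>{0 <..}. principal {(x, y). dist x y < e})"
definition
  "open (U :: quat set) \<longleftrightarrow> (\<forall>x\<in>U. eventually (\<lambda>(x', y). x' = x \<longrightarrow> y \<in> U) uniformity)"
definition "inverse x = (1 / quat_norm2 x) *\<^sub>R Quat (qre x) (- qi x) (- qj x) (- qk x)"
definition "x div y = x * inverse (y :: quat)"

instance
proof
  fix x y :: quat and r :: real
  show "sgn x = x /\<^sub>R norm x" by (simp add: sgn_quat_def)
  show "dist x y = norm (x - y)" by (simp add: dist_quat_def)
  show "(uniformity :: (quat \<times> quat) filter) = (INF e\<in>{0 <..}. principal {(x, y). dist x y < e})"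
    by (simp add: uniformity_quat_def)
  show "open U \<longleftrightarrow> (\<forall>x\<in>U. eventually (\<lambda>(x', y). x' = x \<longrightarrow> y \<in> U) uniformity)" for U :: "quat set"
    by (simp add: open_quat_def)
  show "norm x = 0 \<longleftrightarrow> x = 0"
    by (simp add: norm_quat_def quat_norm2_eq_0)
  show "norm (x + y) \<le> norm x + norm y"
  proof -
    have *: "norm z = norm ((qre z, qi z), (qj z, qk z))" for z
      by (simp add: norm_quat_def quat_norm2_def norm_Pair)
    show ?thesis
      unfolding * using norm_triangle_ineq[of "((qre x, qi x), (qj x, qk x))" "((qre y, qi y), (qj y, qk y))"]
      by simp
  qed
  show "norm (r *\<^sub>R x) = \<bar>r\<bar> * norm x"
  proof -
    have "quat_norm2 (r *\<^sub>R x) = r\<^sup>2 * quat_norm2 x"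
      by (simp add: quat_norm2_def power_mult_distrib algebra_simps)
    then show ?thesis by (simp add: norm_quat_def real_sqrt_mult)
  qed
  show "norm (x * y) = norm x * norm y"
    by (simp add: norm_quat_def quat_norm2_mult real_sqrt_mult)
  show "x div y = x * inverse y" by (simp add: divide_quat_def)
  show "inverse 0 = (0 :: quat)"
    by (simp add: inverse_quat_def quat_eq_iff)
  have inv: "x * Quat (qre x) (- qi x) (- qj x) (- qk x) = quat_norm2 x *\<^sub>R 1"
       "Quat (qre x) (- qi x) (- qj x) (- qk x) * x = quat_norm2 x *\<^sub>R 1"
    by (simp_all add: quat_eq_iff times_quat_def quat_norm2_def power2_eq_square)
  show "inverse x * x = 1" "x * inverse x = 1" if "x \<noteq> 0"
    using that by (simp_all add: inverse_quat_def inv quat_norm2_eq_0)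
qed

end

instance quat :: banach
proof
  fix X :: "nat \<Rightarrow> quat" assume X: "Cauchy X"
  have le: "norm (qre z) \<le> norm z" "norm (qi z) \<le> norm z" "norm (qj z) \<le> norm z" "norm (qk z) \<le> norm z" for z
    by (auto simp: norm_quat_def quat_norm2_def intro!: real_le_rsqrt)
  have conv: "convergent (\<lambda>n. f (X n))"
    if "\<And>x y. f (x - y) = f x - f y" "\<And>z. norm (f z) \<le> norm z" for f :: "quat \<Rightarrow> real"
  proof -
    have "Cauchy (\<lambda>n. f (X n))"
      unfolding Cauchy_iff
    proof (intro allI impI)
      fix e :: real assume "e > 0"
      then obtain M where "\<forall>m\<ge>M. \<forall>n\<ge>M. norm (X m - X n) < e"
        using X unfolding Cauchy_iff by blast
      then show "\<exists>M. \<forall>m\<ge>M. \<forall>n\<ge>M. norm (f (X m) - f (X n)) < e"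
        using that by (metis le_less_trans)
    qed
    then show ?thesis by (simp add: Cauchy_convergent_iff)
  qed
  obtain a b c d where l: "(\<lambda>n. qre (X n)) \<longlonglongrightarrow> a" "(\<lambda>n. qi (X n)) \<longlonglongrightarrow> b"
      "(\<lambda>n. qj (X n)) \<longlonglongrightarrow> c" "(\<lambda>n. qk (X n)) \<longlonglongrightarrow> d"
    using conv[of qre] conv[of qi] conv[of qj] conv[of qk] le by (auto simp: convergent_def)
  have "(\<lambda>n. sqrt ((qre (X n) - a)\<^sup>2 + (qi (X n) - b)\<^sup>2 + (qj (X n) - c)\<^sup>2 + (qk (X n) - d)\<^sup>2))
      \<longlonglongrightarrow> sqrt ((a - a)\<^sup>2 + (b - b)\<^sup>2 + (c - c)\<^sup>2 + (d - d)\<^sup>2)"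
    by (intro tendsto_intros l)
  then have "(\<lambda>n. norm (X n - Quat a b c d)) \<longlonglongrightarrow> 0"
    by (simp add: norm_quat_def quat_norm2_def)
  then have "X \<longlonglongrightarrow> Quat a b c d"
    using LIM_zero_iff tendsto_norm_zero_iff by blast
  then show "convergent X" by (auto simp: convergent_def)
qed

section \<open>Infinite matrices\<close>

text \<open>Rows and columns are indexed by \<^typ>\<open>nat\<close>, i.e. from 0 instead of 1.\<close>

text \<open>The operator norm of the finite matrix with rows \<open>I\<close> and columns \<open>J\<close>, acting from the left on
  column vectors with the Euclidean norm.\<close>

definition fin_opnorm :: "nat set \<Rightarrow> nat set \<Rightarrow> (nat \<Rightarrow> nat \<Rightarrow> 'a::real_normed_div_algebra) \<Rightarrow> real" where
  "fin_opnorm I J A =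
    (SUP x\<in>{x. L2_set (\<lambda>j. norm (x j)) J \<le> 1}. L2_set (\<lambda>i. norm (\<Sum>j\<in>J. A i j * x j)) I)"

definition mat_single :: "nat \<Rightarrow> nat \<Rightarrow> 'a::zero \<Rightarrow> nat \<Rightarrow> nat \<Rightarrow> 'a" where
  "mat_single i j c = (\<lambda>k l. if k = i \<and> l = j then c else 0)"

definition shell_sum :: "(nat \<Rightarrow> nat \<Rightarrow> 'a::comm_monoid_add) \<Rightarrow> nat \<Rightarrow> nat \<Rightarrow> nat \<Rightarrow> nat \<Rightarrow> 'a" where
  "shell_sum A m p =
    (\<Sum>i=m..p. (\<Sum>k<i. mat_single k i (A k i) + mat_single i k (A i k)) + mat_single i i (A i i))"

text \<open>All nonzero entries of \<^term>\<open>shell_sum A m p\<close> lie in the block \<open>{..p} \<times> {..p}\<close>.\<close>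

definition Nn_carrier :: "(nat \<Rightarrow> nat \<Rightarrow> 'a::real_normed_div_algebra) set" where
  "Nn_carrier = {A. \<forall>\<epsilon>>0. \<exists>n0. \<forall>m p. n0 \<le> m \<and> m \<le> p \<longrightarrow> fin_opnorm {..p} {..p} (shell_sum A m p) < \<epsilon>}"

definition mat_mult :: "(nat \<Rightarrow> nat \<Rightarrow> 'a::real_normed_div_algebra) \<Rightarrow> (nat \<Rightarrow> nat \<Rightarrow> 'a) \<Rightarrow> nat \<Rightarrow> nat \<Rightarrow> 'a" where
  "mat_mult A B = (\<lambda>i j. \<Sum>\<xi>. A i \<xi> * B \<xi> j)"

subsection \<open>Bounded matrices\<close>

definition mat_bnd :: "(nat \<Rightarrow> nat \<Rightarrow> 'a::real_normed_div_algebra) \<Rightarrow> real \<Rightarrow> bool" where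
  "mat_bnd A c \<longleftrightarrow> 0 \<le> c \<and> (\<forall>I J x. finite I \<longrightarrow> finite J \<longrightarrow>
     L2_set (\<lambda>i. norm (\<Sum>j\<in>J. A i j * x j)) I \<le> c * L2_set (\<lambda>j. norm (x j)) J)"

lemma mat_bndD:
  "mat_bnd A c \<Longrightarrow> finite I \<Longrightarrow> finite J \<Longrightarrow>
    L2_set (\<lambda>i. norm (\<Sum>j\<in>J. A i j * x j)) I \<le> c * L2_set (\<lambda>j. norm (x j)) J"
  by (auto simp: mat_bnd_def)

lemma mat_bnd_nonneg: "mat_bnd A c \<Longrightarrow> 0 \<le> c"
  by (auto simp: mat_bnd_def)

lemma fin_mat_bound:
  fixes A :: "nat \<Rightarrow> nat \<Rightarrow> 'a::real_normed_div_algebra"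
  assumes "finite I" "finite J"
  shows "L2_set (\<lambda>i. norm (\<Sum>j\<in>J. A i j * x j)) I
    \<le> (\<Sum>i\<in>I. \<Sum>j\<in>J. norm (A i j)) * L2_set (\<lambda>j. norm (x j)) J"
proof -
  have "L2_set (\<lambda>i. norm (\<Sum>j\<in>J. A i j * x j)) I \<le> (\<Sum>i\<in>I. norm (\<Sum>j\<in>J. A i j * x j))"
    by (rule L2_set_le_sum) auto
  also have "\<dots> \<le> (\<Sum>i\<in>I. \<Sum>j\<in>J. norm (A i j) * L2_set (\<lambda>j. norm (x j)) J)"
  proof (rule sum_mono)
    fix i
    have "norm (\<Sum>j\<in>J. A i j * x j) \<le> (\<Sum>j\<in>J. norm (A i j) * norm (x j))"
      by (rule order_trans[OF norm_sum]) (simp add: norm_mult)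
    also have "\<dots> \<le> (\<Sum>j\<in>J. norm (A i j) * L2_set (\<lambda>j. norm (x j)) J)"
      by (intro sum_mono mult_left_mono member_le_L2_set assms) auto
    finally show "norm (\<Sum>j\<in>J. A i j * x j) \<le> (\<Sum>j\<in>J. norm (A i j) * L2_set (\<lambda>j. norm (x j)) J)" .
  qed
  finally show ?thesis by (simp add: sum_distrib_right)
qed

lemma fin_opnorm_least:
  assumes "\<And>x. L2_set (\<lambda>i. norm (\<Sum>j\<in>J. A i j * x j)) I \<le> c * L2_set (\<lambda>j. norm (x j)) J" "0 \<le> c"
  shows "fin_opnorm I J A \<le> c"
  unfolding fin_opnorm_def
proof (rule cSUP_least)
  have "(\<lambda>j. 0) \<in> {x. L2_set (\<lambda>j. norm (x j :: 'a)) J \<le> 1}" by (simp add: L2_set_def)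
  then show "{x. L2_set (\<lambda>j. norm (x j :: 'a)) J \<le> 1} \<noteq> {}" by (rule ex_in_conv[THEN iffD1, OF exI])
  fix x :: "nat \<Rightarrow> 'a" assume "x \<in> {x. L2_set (\<lambda>j. norm (x j)) J \<le> 1}"
  then have "c * L2_set (\<lambda>j. norm (x j)) J \<le> c * 1"
    using assms(2) by (intro mult_left_mono) auto
  then show "L2_set (\<lambda>i. norm (\<Sum>j\<in>J. A i j * x j)) I \<le> c"
    using assms(1)[of x] by linarith
qed

lemma fin_opnorm_upper1:
  fixes A :: "nat \<Rightarrow> nat \<Rightarrow> 'a::real_normed_div_algebra"
  assumes "finite I" "finite J" "L2_set (\<lambda>j. norm (x j)) J \<le> 1"
  shows "L2_set (\<lambda>i. norm (\<Sum>j\<in>J. A i j * x j)) I \<le> fin_opnorm I J A"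
  unfolding fin_opnorm_def
proof (rule cSUP_upper)
  show "x \<in> {x. L2_set (\<lambda>j. norm (x j)) J \<le> 1}" using assms by simp
  show "bdd_above ((\<lambda>x. L2_set (\<lambda>i. norm (\<Sum>j\<in>J. A i j * x j)) I) ` {x. L2_set (\<lambda>j. norm (x j)) J \<le> 1})"
  proof (rule bdd_aboveI2)
    fix x :: "nat \<Rightarrow> 'a" assume "x \<in> {x. L2_set (\<lambda>j. norm (x j)) J \<le> 1}"
    then have "(\<Sum>i\<in>I. \<Sum>j\<in>J. norm (A i j)) * L2_set (\<lambda>j. norm (x j)) J \<le> (\<Sum>i\<in>I. \<Sum>j\<in>J. norm (A i j)) * 1"
      by (intro mult_left_mono sum_nonneg) auto
    then show "L2_set (\<lambda>i. norm (\<Sum>j\<in>J. A i j * x j)) I \<le> (\<Sum>i\<in>I. \<Sum>j\<in>J. norm (A i j))"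
      using fin_mat_bound[OF assms(1,2), of A x] by linarith
  qed
qed

lemma fin_opnorm_nonneg: "finite I \<Longrightarrow> finite J \<Longrightarrow> 0 \<le> fin_opnorm I J A"
  using fin_opnorm_upper1[of I J "\<lambda>j. 0" A] by (simp add: L2_set_def)

lemma fin_opnorm_upper:
  fixes A :: "nat \<Rightarrow> nat \<Rightarrow> 'a::real_normed_div_algebra"
  assumes "finite I" "finite J"
  shows "L2_set (\<lambda>i. norm (\<Sum>j\<in>J. A i j * x j)) I \<le> fin_opnorm I J A * L2_set (\<lambda>j. norm (x j)) J"
proof (cases "L2_set (\<lambda>j. norm (x j)) J = 0")
  case True
  then have "\<forall>j\<in>J. x j = 0" using assms by (simp add: L2_set_eq_0_iff)
  then show ?thesis using True by (simp add: L2_set_def)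
next
  case False
  define r where "r = L2_set (\<lambda>j. norm (x j)) J"
  have r: "r > 0" using False L2_set_nonneg[of "\<lambda>j. norm (x j)" J] unfolding r_def by linarith
  define y where "y j = x j /\<^sub>R r" for j
  have "L2_set (\<lambda>j. norm (y j)) J = inverse r * r"
    unfolding r_def y_def using r by (simp add: L2_set_right_distrib r_def)
  then have "L2_set (\<lambda>i. norm (\<Sum>j\<in>J. A i j * y j)) I \<le> fin_opnorm I J A"
    using r by (intro fin_opnorm_upper1 assms) simp
  moreover have "L2_set (\<lambda>i. norm (\<Sum>j\<in>J. A i j * y j)) I = inverse r * L2_set (\<lambda>i. norm (\<Sum>j\<in>J. A i j * x j)) I"
    using r by (simp add: y_def scaleR_sum_right[symmetric] L2_set_right_distrib)
  ultimately show ?thesis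
    using r unfolding r_def[symmetric] by (simp add: field_simps)
qed

lemma mat_bnd_iff:
  "mat_bnd A c \<longleftrightarrow> 0 \<le> c \<and> (\<forall>I J. finite I \<longrightarrow> finite J \<longrightarrow> fin_opnorm I J A \<le> c)"
proof
  show "0 \<le> c \<and> (\<forall>I J. finite I \<longrightarrow> finite J \<longrightarrow> fin_opnorm I J A \<le> c)" if "mat_bnd A c"
    using that by (auto simp: mat_bnd_def intro!: fin_opnorm_least)
  assume *: "0 \<le> c \<and> (\<forall>I J. finite I \<longrightarrow> finite J \<longrightarrow> fin_opnorm I J A \<le> c)"
  show "mat_bnd A c"
    unfolding mat_bnd_def
  proof (intro conjI allI impI)
    show "0 \<le> c" using * by simp
    fix I J :: "nat set" and x :: "nat \<Rightarrow> 'a" assume f: "finite I" "finite J"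
    have "fin_opnorm I J A * L2_set (\<lambda>j. norm (x j)) J \<le> c * L2_set (\<lambda>j. norm (x j)) J"
      using * f by (intro mult_right_mono) auto
    then show "L2_set (\<lambda>i. norm (\<Sum>j\<in>J. A i j * x j)) I \<le> c * L2_set (\<lambda>j. norm (x j)) J"
      using fin_opnorm_upper[OF f, of A x] by linarith
  qed
qed

lemma L2_set_mono2: "finite J \<Longrightarrow> I \<subseteq> J \<Longrightarrow> L2_set f I \<le> L2_set f J"
  unfolding L2_set_def by (rule real_sqrt_le_mono, rule sum_mono2) simp_all

lemma fin_opnorm_mono:
  fixes A :: "nat \<Rightarrow> nat \<Rightarrow> 'a::real_normed_div_algebra"
  assumes "finite I'" "finite J'" "I \<subseteq> I'" "J \<subseteq> J'"
  shows "fin_opnorm I J A \<le> fin_opnorm I' J' A"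
proof (rule fin_opnorm_least)
  fix x :: "nat \<Rightarrow> 'a"
  define y where "y j = (if j \<in> J then x j else 0)" for j
  have s: "(\<Sum>j\<in>J'. A i j * y j) = (\<Sum>j\<in>J. A i j * x j)" for i
    using assms by (intro sum.mono_neutral_cong_right) (auto simp: y_def)
  have n: "L2_set (\<lambda>j. norm (y j)) J' = L2_set (\<lambda>j. norm (x j)) J"
    unfolding L2_set_def using assms
    by (intro arg_cong[where f=sqrt] sum.mono_neutral_cong_right) (auto simp: y_def)
  have "L2_set (\<lambda>i. norm (\<Sum>j\<in>J. A i j * x j)) I \<le> L2_set (\<lambda>i. norm (\<Sum>j\<in>J. A i j * x j)) I'"
    using assms by (intro L2_set_mono2)
  also have "\<dots> \<le> fin_opnorm I' J' A * L2_set (\<lambda>j. norm (x j)) J"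
    using fin_opnorm_upper[of I' J' A y] assms by (simp add: s n)
  finally show "L2_set (\<lambda>i. norm (\<Sum>j\<in>J. A i j * x j)) I \<le> fin_opnorm I' J' A * L2_set (\<lambda>j. norm (x j)) J" .
qed (use assms in \<open>auto intro: fin_opnorm_nonneg\<close>)

lemma mat_bndI_blocks:
  assumes "\<And>p. p \<ge> N \<Longrightarrow> fin_opnorm {..p} {..p} A \<le> c" "0 \<le> c"
  shows "mat_bnd A c"
  unfolding mat_bnd_iff
proof (intro conjI allI impI)
  fix I J :: "nat set" assume f: "finite I" "finite J"
  then obtain p where "I \<union> J \<subseteq> {..p}" using finite_nat_iff_bounded_le[of "I \<union> J"] by auto
  then have "fin_opnorm I J A \<le> fin_opnorm {..max N p} {..max N p} A"
    by (intro fin_opnorm_mono) auto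
  then show "fin_opnorm I J A \<le> c" using assms(1)[of "max N p"] by simp
qed (use assms in auto)

lemma mat_bnd_mono: "mat_bnd A c \<Longrightarrow> c \<le> d \<Longrightarrow> mat_bnd A d"
  unfolding mat_bnd_iff by force

lemma mat_bnd_entry: assumes "mat_bnd A c" shows "norm (A i j) \<le> c"
  using mat_bndD[OF assms, of "{i}" "{j}" "\<lambda>_. 1"] by simp

lemma mat_bnd_zero: "mat_bnd (\<lambda>i j. 0) 0"
  by (simp add: mat_bnd_def L2_set_def)

lemma mat_bnd_add:
  assumes "mat_bnd A c" "mat_bnd B d"
  shows "mat_bnd (\<lambda>i j. A i j + B i j) (c + d)"
  unfolding mat_bnd_def
proof (intro conjI allI impI)
  show "0 \<le> c + d" using assms by (simp add: mat_bnd_nonneg)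
  fix I J :: "nat set" and x :: "nat \<Rightarrow> 'a" assume f: "finite I" "finite J"
  have "L2_set (\<lambda>i. norm (\<Sum>j\<in>J. (A i j + B i j) * x j)) I
      \<le> L2_set (\<lambda>i. norm (\<Sum>j\<in>J. A i j * x j) + norm (\<Sum>j\<in>J. B i j * x j)) I"
    by (intro L2_set_mono) (auto simp: distrib_right sum.distrib intro: norm_triangle_ineq)
  also have "\<dots> \<le> L2_set (\<lambda>i. norm (\<Sum>j\<in>J. A i j * x j)) I + L2_set (\<lambda>i. norm (\<Sum>j\<in>J. B i j * x j)) I"
    by (rule L2_set_triangle_ineq)
  also have "\<dots> \<le> (c + d) * L2_set (\<lambda>j. norm (x j)) J"
    using mat_bndD[OF assms(1) f, of x] mat_bndD[OF assms(2) f, of x] by (simp add: distrib_right)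
  finally show "L2_set (\<lambda>i. norm (\<Sum>j\<in>J. (A i j + B i j) * x j)) I \<le> (c + d) * L2_set (\<lambda>j. norm (x j)) J" .
qed

lemma mat_bnd_lmult:
  assumes "mat_bnd A c"
  shows "mat_bnd (\<lambda>i j. a * A i j) (norm a * c)"
  unfolding mat_bnd_def
proof (intro conjI allI impI)
  show "0 \<le> norm a * c" using assms by (simp add: mat_bnd_nonneg)
  fix I J :: "nat set" and x :: "nat \<Rightarrow> 'a" assume f: "finite I" "finite J"
  have "(\<Sum>j\<in>J. a * A i j * x j) = a * (\<Sum>j\<in>J. A i j * x j)" for i
    by (simp add: sum_distrib_left mult.assoc)
  then have "L2_set (\<lambda>i. norm (\<Sum>j\<in>J. a * A i j * x j)) I = norm a * L2_set (\<lambda>i. norm (\<Sum>j\<in>J. A i j * x j)) I"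
    by (simp add: norm_mult L2_set_right_distrib)
  also have "\<dots> \<le> norm a * (c * L2_set (\<lambda>j. norm (x j)) J)"
    by (intro mult_left_mono mat_bndD assms f) auto
  finally show "L2_set (\<lambda>i. norm (\<Sum>j\<in>J. a * A i j * x j)) I \<le> norm a * c * L2_set (\<lambda>j. norm (x j)) J"
    by (simp add: mult.assoc)
qed

lemma mat_bnd_diff:
  assumes "mat_bnd A c" "mat_bnd B d"
  shows "mat_bnd (\<lambda>i j. A i j - B i j) (c + d)"
  using mat_bnd_add[OF assms(1) mat_bnd_lmult[OF assms(2), of "-1"]] by simp

subsection \<open>Truncations\<close>

definition mat_block :: "(nat \<Rightarrow> nat \<Rightarrow> 'a::zero) \<Rightarrow> nat \<Rightarrow> nat \<Rightarrow> nat \<Rightarrow> 'a" where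
  "mat_block A n = (\<lambda>i j. if max i j < n then A i j else 0)"

definition mat_tail :: "(nat \<Rightarrow> nat \<Rightarrow> 'a::zero) \<Rightarrow> nat \<Rightarrow> nat \<Rightarrow> nat \<Rightarrow> 'a" where
  "mat_tail A n = (\<lambda>i j. if max i j < n then 0 else A i j)"

lemma mat_bnd_block:
  assumes "mat_bnd A c"
  shows "mat_bnd (mat_block A n) c"
  unfolding mat_bnd_def
proof (intro conjI allI impI)
  show "0 \<le> c" using assms by (simp add: mat_bnd_nonneg)
  fix I J :: "nat set" and x :: "nat \<Rightarrow> 'a" assume f: "finite I" "finite J"
  have e: "(\<Sum>j\<in>J. mat_block A n i j * x j) = (if i < n then \<Sum>j\<in>J \<inter> {..<n}. A i j * x j else 0)" for i
    using f by (auto simp: mat_block_def sum.inter_restrict intro!: sum.cong)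
  have "L2_set (\<lambda>i. norm (\<Sum>j\<in>J. mat_block A n i j * x j)) I = L2_set (\<lambda>i. norm (\<Sum>j\<in>J \<inter> {..<n}. A i j * x j)) (I \<inter> {..<n})"
    unfolding L2_set_def e using f by (intro arg_cong[where f=sqrt] sum.mono_neutral_cong_right) auto
  also have "\<dots> \<le> c * L2_set (\<lambda>j. norm (x j)) (J \<inter> {..<n})"
    using f by (intro mat_bndD assms) auto
  also have "\<dots> \<le> c * L2_set (\<lambda>j. norm (x j)) J"
    using f assms by (intro mult_left_mono L2_set_mono2 mat_bnd_nonneg) auto
  finally show "L2_set (\<lambda>i. norm (\<Sum>j\<in>J. mat_block A n i j * x j)) I \<le> c * L2_set (\<lambda>j. norm (x j)) J" .
qed

lemma mat_bnd_block_ex: "\<exists>c. mat_bnd (mat_block A n) c"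
proof -
  define c where "c = (\<Sum>i<n. \<Sum>j<n. norm (A i j))"
  have eq: "fin_opnorm {..p} {..p} (mat_block A n) \<le> c" if "p \<ge> n" for p
  proof (rule fin_opnorm_least)
    fix x :: "nat \<Rightarrow> 'a"
    have "(\<Sum>i\<le>p. \<Sum>j\<le>p. norm (mat_block A n i j)) = (\<Sum>i<n. \<Sum>j\<le>p. norm (mat_block A n i j))"
      using that by (intro sum.mono_neutral_right) (auto simp: mat_block_def intro!: sum.neutral)
    also have "\<dots> = c"
      unfolding c_def using that
      by (intro sum.cong refl sum.mono_neutral_cong_right) (auto simp: mat_block_def)
    finally show "L2_set (\<lambda>i. norm (\<Sum>j\<le>p. mat_block A n i j * x j)) {..p} \<le> c * L2_set (\<lambda>j. norm (x j)) {..p}"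
      using fin_mat_bound[of "{..p}" "{..p}" "mat_block A n" x] by simp
  qed (auto simp: c_def intro!: sum_nonneg)
  have "mat_bnd (mat_block A n) c"
    by (rule mat_bndI_blocks[of n]) (use eq in \<open>auto simp: c_def intro!: sum_nonneg\<close>)
  then show ?thesis by blast
qed

lemma mat_block_plus_tail:
  fixes A :: "nat \<Rightarrow> nat \<Rightarrow> 'a::monoid_add"
  shows "A = (\<lambda>i j. mat_block A n i j + mat_tail A n i j)"
  by (auto simp: mat_block_def mat_tail_def fun_eq_iff)

lemma sum_fun_apply: "(\<Sum>i\<in>S. f i) x = (\<Sum>i\<in>S. f i x)"
  by (induction S rule: infinite_finite_induct) auto

lemma shell_sum_apply:
  fixes A :: "nat \<Rightarrow> nat \<Rightarrow> 'a::comm_monoid_add"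
  shows "shell_sum A m p i j = (if m \<le> max i j \<and> max i j \<le> p then A i j else 0)"
proof -
  have inner: "((\<Sum>k<r. mat_single k r (A k r) + mat_single r k (A r k)) + mat_single r r (A r r)) i j
     = (if r = max i j then A i j else 0)" for r
  proof -
    have "(\<Sum>k<r. (if i = k \<and> j = r then A k r else 0) + (if i = r \<and> j = k then A r k else 0))
      = (\<Sum>k<r. (if k = i then if j = r then A i j else 0 else 0)) + (\<Sum>k<r. (if k = j then if i = r then A i j else 0 else 0))"
      unfolding sum.distrib[symmetric] by (intro sum.cong) auto
    also have "\<dots> = (if i < r \<and> j = r then A i j else 0) + (if j < r \<and> i = r then A i j else 0)"
      by (simp add: sum.delta)
    finally show ?thesis
      by (auto simp: sum_fun_apply mat_single_def max_def)
  qed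
  show ?thesis
    unfolding shell_sum_def sum_fun_apply inner by (simp add: sum.delta')
qed

lemma Nn_carrier_iff:
  fixes A :: "nat \<Rightarrow> nat \<Rightarrow> 'a::real_normed_div_algebra"
  shows "A \<in> Nn_carrier \<longleftrightarrow> (\<forall>\<epsilon>>0. \<exists>n. mat_bnd (mat_tail A n) \<epsilon>)"
proof (intro iffI allI impI)
  fix \<epsilon> :: real assume A: "A \<in> Nn_carrier" and "\<epsilon> > 0"
  then obtain n where n: "\<And>m p. n \<le> m \<Longrightarrow> m \<le> p \<Longrightarrow> fin_opnorm {..p} {..p} (shell_sum A m p) < \<epsilon>"
    unfolding Nn_carrier_def by blast
  have "mat_bnd (mat_tail A n) \<epsilon>"
  proof (rule mat_bndI_blocks[of n])
    fix p assume "n \<le> p"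
    have "fin_opnorm {..p} {..p} (mat_tail A n) = fin_opnorm {..p} {..p} (shell_sum A n p)"
      unfolding fin_opnorm_def
      by (intro SUP_cong refl L2_set_cong arg_cong[where f=norm] sum.cong)
         (auto simp: shell_sum_apply mat_tail_def)
    then show "fin_opnorm {..p} {..p} (mat_tail A n) \<le> \<epsilon>" using n[of n p] \<open>n \<le> p\<close> by simp
  qed (use \<open>\<epsilon> > 0\<close> in simp)
  then show "\<exists>n. mat_bnd (mat_tail A n) \<epsilon>" by blast
next
  assume *: "\<forall>\<epsilon>>0. \<exists>n. mat_bnd (mat_tail A n) \<epsilon>"
  show "A \<in> Nn_carrier"
    unfolding Nn_carrier_def
  proof (intro CollectI allI impI)
    fix \<epsilon> :: real assume "\<epsilon> > 0"
    then obtain n where n: "mat_bnd (mat_tail A n) (\<epsilon>/3)" using *[rule_format, of "\<epsilon>/3"] by auto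
    have "fin_opnorm {..p} {..p} (shell_sum A m p) < \<epsilon>" if "n \<le> m \<and> m \<le> p" for m p
    proof -
      have "shell_sum A m p = (\<lambda>i j. mat_block (mat_tail A n) (Suc p) i j - mat_block (mat_tail A n) m i j)"
        using that by (auto simp: fun_eq_iff shell_sum_apply mat_block_def mat_tail_def)
      then have "mat_bnd (shell_sum A m p) (\<epsilon>/3 + \<epsilon>/3)"
        using n by (simp only:, intro mat_bnd_diff mat_bnd_block)
      then have "fin_opnorm {..p} {..p} (shell_sum A m p) \<le> \<epsilon>/3 + \<epsilon>/3"
        unfolding mat_bnd_iff by blast
      then show ?thesis using \<open>\<epsilon> > 0\<close> by linarith
    qed
    then show "\<exists>n0. \<forall>m p. n0 \<le> m \<and> m \<le> p \<longrightarrow> fin_opnorm {..p} {..p} (shell_sum A m p) < \<epsilon>" by blast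
  qed
qed

lemma Nn_carrier_bnd:
  assumes "A \<in> Nn_carrier" shows "\<exists>c. mat_bnd A c"
proof -
  obtain n where "mat_bnd (mat_tail A n) 1" using assms unfolding Nn_carrier_iff by force
  moreover obtain c where "mat_bnd (mat_block A n) c" using mat_bnd_block_ex by blast
  ultimately have "mat_bnd A (c + 1)"
    by (subst mat_block_plus_tail[of A n]) (intro mat_bnd_add)
  then show ?thesis by blast
qed

lemma mat_bnd_tail:
  assumes "mat_bnd A c" shows "mat_bnd (mat_tail A n) (2 * c)"
proof -
  have "mat_tail A n = (\<lambda>i j. A i j - mat_block A n i j)"
    by (auto simp: mat_tail_def mat_block_def fun_eq_iff)
  then show ?thesis using mat_bnd_diff[OF assms mat_bnd_block[OF assms, of n]] by simp
qed

lemma mat_bnd_tail_mono: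
  assumes "mat_bnd (mat_tail A n) c" "n \<le> m" shows "mat_bnd (mat_tail A m) (2 * c)"
proof -
  have "mat_tail A m = mat_tail (mat_tail A n) m"
    using assms(2) by (auto simp: mat_tail_def fun_eq_iff)
  then show ?thesis using mat_bnd_tail[OF assms(1), of m] by simp
qed

lemma Nn_carrier_zero: "(\<lambda>i j. 0) \<in> Nn_carrier"
  unfolding Nn_carrier_iff
  using mat_bnd_mono[OF mat_bnd_zero] by (auto simp: mat_tail_def intro: less_imp_le)

lemma Nn_carrier_add:
  assumes "A \<in> Nn_carrier" "B \<in> Nn_carrier"
  shows "(\<lambda>i j. A i j + B i j) \<in> Nn_carrier"
  unfolding Nn_carrier_iff
proof (intro allI impI)
  fix \<epsilon> :: real assume "\<epsilon> > 0"
  then have "\<epsilon>/4 > 0" by simp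
  then obtain n m where n: "mat_bnd (mat_tail A n) (\<epsilon>/4)" "mat_bnd (mat_tail B m) (\<epsilon>/4)"
    using assms unfolding Nn_carrier_iff by meson
  have "mat_bnd (\<lambda>i j. mat_tail A (max n m) i j + mat_tail B (max n m) i j) (2*(\<epsilon>/4) + 2*(\<epsilon>/4))"
    by (intro mat_bnd_add mat_bnd_tail_mono[OF n(1)] mat_bnd_tail_mono[OF n(2)]) auto
  moreover have "(\<lambda>i j. mat_tail A (max n m) i j + mat_tail B (max n m) i j) = mat_tail (\<lambda>i j. A i j + B i j) (max n m)"
    by (auto simp: mat_tail_def fun_eq_iff)
  ultimately show "\<exists>n. mat_bnd (mat_tail (\<lambda>i j. A i j + B i j) n) \<epsilon>"
    by (auto intro!: exI[of _ "max n m"])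
qed

lemma Nn_carrier_lmult:
  assumes "A \<in> Nn_carrier"
  shows "(\<lambda>i j. a * A i j) \<in> Nn_carrier"
  unfolding Nn_carrier_iff
proof (intro allI impI)
  fix \<epsilon> :: real assume \<epsilon>: "\<epsilon> > 0"
  have "\<epsilon> / (norm a + 1) > 0" using \<epsilon> by (simp add: add_nonneg_pos)
  then obtain n where n: "mat_bnd (mat_tail A n) (\<epsilon> / (norm a + 1))"
    using assms unfolding Nn_carrier_iff by meson
  have "norm a * (\<epsilon> / (norm a + 1)) \<le> \<epsilon>"
    using \<epsilon> by (simp add: field_simps add_pos_nonneg)
  then have "mat_bnd (\<lambda>i j. a * mat_tail A n i j) \<epsilon>"
    using mat_bnd_lmult[OF n, of a] mat_bnd_mono by blast
  moreover have "(\<lambda>i j. a * mat_tail A n i j) = mat_tail (\<lambda>i j. a * A i j) n"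
    by (auto simp: mat_tail_def fun_eq_iff)
  ultimately show "\<exists>n. mat_bnd (mat_tail (\<lambda>i j. a * A i j) n) \<epsilon>" by auto
qed

subsection \<open>The matrix product\<close>

lemma mat_bnd_row:
  assumes "mat_bnd A c" "finite F"
  shows "L2_set (\<lambda>\<xi>. norm (A i \<xi>)) F \<le> c"
proof -
  define S where "S = L2_set (\<lambda>\<xi>. norm (A i \<xi>)) F"
  have S: "0 \<le> S" by (simp add: S_def)
  have S2: "(\<Sum>\<xi>\<in>F. (norm (A i \<xi>))\<^sup>2) = S\<^sup>2"
    unfolding S_def L2_set_def by (simp add: sum_nonneg)
  define x where "x j = (if A i j = 0 then 0 else inverse (A i j) * of_real ((norm (A i j))\<^sup>2))" for j
  have x: "A i j * x j = of_real ((norm (A i j))\<^sup>2)" for j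
    by (simp add: x_def mult.assoc[symmetric])
  have nx: "norm (x j) = norm (A i j)" for j
    by (simp add: x_def norm_mult norm_inverse norm_power power2_eq_square)
  have "(\<Sum>j\<in>F. A i j * x j) = of_real (S\<^sup>2)"
    unfolding x S2[symmetric] by simp
  then have nS: "norm (\<Sum>j\<in>F. A i j * x j) = S\<^sup>2"
    by (simp add: norm_power)
  have "norm (\<Sum>j\<in>F. A i j * x j) \<le> c * S"
    using mat_bndD[OF assms(1), of "{i}" F x] assms(2) by (simp add: nx S_def[symmetric])
  then have "S\<^sup>2 \<le> c * S" by (simp only: nS)
  then have "S \<le> c"
    using S mat_bnd_nonneg[OF assms(1)] by (cases "S = 0") (auto simp: power2_eq_square)
  then show ?thesis by (simp add: S_def)
qed

lemma mat_bnd_col: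
  assumes "mat_bnd B d" "finite F"
  shows "L2_set (\<lambda>\<xi>. norm (B \<xi> j)) F \<le> d"
  using mat_bndD[OF assms(1,2), of "{j}" "\<lambda>_. 1"] by simp

lemma mat_mult_summable_norm:
  assumes "mat_bnd A c" "mat_bnd B d"
  shows "summable (\<lambda>\<xi>. norm (A i \<xi> * B \<xi> j))"
proof (rule summableI_nonneg_bounded[where x = "c * d"])
  fix n
  have "(\<Sum>\<xi><n. norm (A i \<xi> * B \<xi> j)) \<le> L2_set (\<lambda>\<xi>. norm (A i \<xi>)) {..<n} * L2_set (\<lambda>\<xi>. norm (B \<xi> j)) {..<n}"
    using L2_set_mult_ineq[of "\<lambda>\<xi>. norm (A i \<xi>)" "\<lambda>\<xi>. norm (B \<xi> j)" "{..<n}"] by (simp add: norm_mult)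
  also have "\<dots> \<le> c * d"
    by (intro mult_mono mat_bnd_row[OF assms(1)] mat_bnd_col[OF assms(2)] mat_bnd_nonneg[OF assms(1)]) auto
  finally show "(\<Sum>\<xi><n. norm (A i \<xi> * B \<xi> j)) \<le> c * d" .
qed auto

lemma mat_mult_summable:
  fixes A :: "nat \<Rightarrow> nat \<Rightarrow> 'a::{real_normed_div_algebra, banach}"
  assumes "mat_bnd A c" "mat_bnd B d"
  shows "summable (\<lambda>\<xi>. A i \<xi> * B \<xi> j)"
  by (rule summable_norm_cancel[OF mat_mult_summable_norm[OF assms]])

lemma mat_bnd_mult:
  fixes A :: "nat \<Rightarrow> nat \<Rightarrow> 'a::{real_normed_div_algebra, banach}"
  assumes "mat_bnd A c" "mat_bnd B d"
  shows "mat_bnd (mat_mult A B) (c * d)"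
  unfolding mat_bnd_def
proof (intro conjI allI impI)
  show "0 \<le> c * d" using assms by (simp add: mat_bnd_nonneg)
  fix I J :: "nat set" and x :: "nat \<Rightarrow> 'a" assume f: "finite I" "finite J"
  have "(\<lambda>N. \<Sum>\<xi><N. A i \<xi> * B \<xi> j) \<longlonglongrightarrow> mat_mult A B i j" for i j
    unfolding mat_mult_def by (rule summable_LIMSEQ[OF mat_mult_summable[OF assms]])
  then have lim: "(\<lambda>N. L2_set (\<lambda>i. norm (\<Sum>j\<in>J. (\<Sum>\<xi><N. A i \<xi> * B \<xi> j) * x j)) I)
      \<longlonglongrightarrow> L2_set (\<lambda>i. norm (\<Sum>j\<in>J. mat_mult A B i j * x j)) I"
    unfolding L2_set_def by (intro tendsto_intros)
  have "L2_set (\<lambda>i. norm (\<Sum>j\<in>J. (\<Sum>\<xi><N. A i \<xi> * B \<xi> j) * x j)) I \<le> c * d * L2_set (\<lambda>j. norm (x j)) J" for N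
  proof -
    have "(\<Sum>j\<in>J. (\<Sum>\<xi><N. A i \<xi> * B \<xi> j) * x j) = (\<Sum>\<xi><N. A i \<xi> * (\<Sum>j\<in>J. B \<xi> j * x j))" for i
      unfolding sum_distrib_left sum_distrib_right by (subst sum.swap) (simp add: mult.assoc)
    then have "L2_set (\<lambda>i. norm (\<Sum>j\<in>J. (\<Sum>\<xi><N. A i \<xi> * B \<xi> j) * x j)) I
        \<le> c * L2_set (\<lambda>\<xi>. norm (\<Sum>j\<in>J. B \<xi> j * x j)) {..<N}"
      using mat_bndD[OF assms(1) f(1), of "{..<N}" "\<lambda>\<xi>. \<Sum>j\<in>J. B \<xi> j * x j"] by simp
    also have "\<dots> \<le> c * (d * L2_set (\<lambda>j. norm (x j)) J)"
      using f by (intro mult_left_mono mat_bndD[OF assms(2)] mat_bnd_nonneg[OF assms(1)]) auto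
    finally show ?thesis by (simp add: mult.assoc)
  qed
  then show "L2_set (\<lambda>i. norm (\<Sum>j\<in>J. mat_mult A B i j * x j)) I \<le> c * d * L2_set (\<lambda>j. norm (x j)) J"
    by (intro LIMSEQ_le_const2[OF lim]) auto
qed

lemma mat_mult_add_left:
  fixes A :: "nat \<Rightarrow> nat \<Rightarrow> 'a::{real_normed_div_algebra, banach}"
  assumes "mat_bnd A c" "mat_bnd B d" "mat_bnd C e"
  shows "mat_mult (\<lambda>i j. A i j + B i j) C = (\<lambda>i j. mat_mult A C i j + mat_mult B C i j)"
  unfolding mat_mult_def
  by (intro ext) (simp add: distrib_right suminf_add[symmetric] mat_mult_summable[OF assms(1,3)] mat_mult_summable[OF assms(2,3)])

lemma mat_mult_add_right:
  fixes A :: "nat \<Rightarrow> nat \<Rightarrow> 'a::{real_normed_div_algebra, banach}"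
  assumes "mat_bnd A c" "mat_bnd B d" "mat_bnd C e"
  shows "mat_mult A (\<lambda>i j. B i j + C i j) = (\<lambda>i j. mat_mult A B i j + mat_mult A C i j)"
  unfolding mat_mult_def
  by (intro ext) (simp add: distrib_left suminf_add[symmetric] mat_mult_summable[OF assms(1,2)] mat_mult_summable[OF assms(1,3)])

lemma mat_mult_blocks:
  fixes A :: "nat \<Rightarrow> nat \<Rightarrow> 'a::real_normed_div_algebra"
  shows "mat_mult A (mat_block B n) i j = (\<Sum>\<xi><n. A i \<xi> * mat_block B n \<xi> j)"
    and "mat_mult (mat_block A n) B i j = (\<Sum>\<xi><n. mat_block A n i \<xi> * B \<xi> j)"
  unfolding mat_mult_def by (intro suminf_finite; auto simp: mat_block_def)+

lemma Nn_carrier_mult: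
  fixes A B :: "nat \<Rightarrow> nat \<Rightarrow> 'a::{real_normed_div_algebra, banach}"
  assumes "A \<in> Nn_carrier" "B \<in> Nn_carrier"
  shows "mat_mult A B \<in> Nn_carrier"
  unfolding Nn_carrier_iff
proof (intro allI impI)
  fix \<epsilon> :: real assume \<epsilon>: "\<epsilon> > 0"
  obtain c d where cd: "mat_bnd A c" "mat_bnd B d" using Nn_carrier_bnd assms by meson
  then have nn: "0 \<le> c" "0 \<le> d" by (auto simp: mat_bnd_nonneg)
  define e where "e = \<epsilon> / (4 * (c + d + 1))"
  have e: "e > 0" using \<epsilon> nn by (simp add: e_def)
  obtain n1 n2 where n12: "mat_bnd (mat_tail A n1) e" "mat_bnd (mat_tail B n2) e"
    using assms e unfolding Nn_carrier_iff by meson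
  define n where "n = max n1 n2"
  have tA: "mat_bnd (mat_tail A n) (2 * e)" and tB: "mat_bnd (mat_tail B n) (2 * e)"
    using mat_bnd_tail_mono[OF n12(1), of n] mat_bnd_tail_mono[OF n12(2), of n] by (auto simp: n_def)
  define R where "R = (\<lambda>i j. mat_mult (mat_tail A n) B i j + mat_mult (mat_block A n) (mat_tail B n) i j)"
  have R: "mat_bnd R (2 * e * d + c * (2 * e))"
    unfolding R_def by (intro mat_bnd_add mat_bnd_mult tA tB cd mat_bnd_block)
  have "mat_mult A B = (\<lambda>i j. mat_mult (mat_block A n) B i j + mat_mult (mat_tail A n) B i j)"
    by (subst mat_block_plus_tail[of A n]) (rule mat_mult_add_left[OF mat_bnd_block[OF cd(1)] tA cd(2)])
  moreover have "mat_mult (mat_block A n) B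
      = (\<lambda>i j. mat_mult (mat_block A n) (mat_block B n) i j + mat_mult (mat_block A n) (mat_tail B n) i j)"
    by (subst mat_block_plus_tail[of B n]) (rule mat_mult_add_right[OF mat_bnd_block[OF cd(1)] mat_bnd_block[OF cd(2)] tB])
  ultimately have eq: "mat_mult A B i j = mat_mult (mat_block A n) (mat_block B n) i j + R i j" for i j
    by (simp add: R_def algebra_simps)
  have "mat_mult (mat_block A n) (mat_block B n) i j = 0" if "\<not> max i j < n" for i j
    using that unfolding mat_mult_blocks by (auto simp: mat_block_def intro!: sum.neutral)
  then have "mat_tail (mat_mult A B) n = mat_tail R n"
    by (auto simp: mat_tail_def eq fun_eq_iff)
  then have "mat_bnd (mat_tail (mat_mult A B) n) (2 * (2 * e * d + c * (2 * e)))"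
    using mat_bnd_tail[OF R, of n] by simp
  moreover have "2 * (2 * e * d + c * (2 * e)) \<le> \<epsilon>"
  proof -
    have "2 * (2 * e * d + c * (2 * e)) = 4 * (c + d) * e" by (simp add: algebra_simps)
    also have "\<dots> \<le> 4 * (c + d + 1) * e" using e by (intro mult_right_mono) auto
    also have "\<dots> = \<epsilon>" using nn by (simp add: e_def)
    finally show ?thesis .
  qed
  ultimately show "\<exists>n. mat_bnd (mat_tail (mat_mult A B) n) \<epsilon>" using mat_bnd_mono by blast
qed

section \<open>The algebra \<open>\<N>\<^sub>n(F)\<close>\<close>

typedef (overloaded) ('a::"{real_normed_div_algebra, banach}") nmat =
    "Nn_carrier :: (nat \<Rightarrow> nat \<Rightarrow> 'a) set"
  morphisms nmat_entry Abs_nmat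
  using Nn_carrier_zero by blast

setup_lifting type_definition_nmat

instantiation nmat :: ("{real_normed_div_algebra, banach}") real_vector
begin

lift_definition zero_nmat :: "'a nmat" is "\<lambda>i j. 0"
  by (rule Nn_carrier_zero)

lift_definition plus_nmat :: "'a nmat \<Rightarrow> 'a nmat \<Rightarrow> 'a nmat" is "\<lambda>A B i j. A i j + B i j"
  by (rule Nn_carrier_add)

lift_definition minus_nmat :: "'a nmat \<Rightarrow> 'a nmat \<Rightarrow> 'a nmat" is "\<lambda>A B i j. A i j - B i j"
  using Nn_carrier_add Nn_carrier_lmult[where a = "-1"] by force

lift_definition uminus_nmat :: "'a nmat \<Rightarrow> 'a nmat" is "\<lambda>A i j. - A i j"
  using Nn_carrier_lmult[where a = "-1"] by force

lift_definition scaleR_nmat :: "real \<Rightarrow> 'a nmat \<Rightarrow> 'a nmat" is "\<lambda>r A i j. r *\<^sub>R A i j"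
  using Nn_carrier_lmult[where a = "of_real r" for r] by (force simp: scaleR_conv_of_real)

instance
  by (standard; transfer) (auto simp: fun_eq_iff algebra_simps)

end

text \<open>Entrywise left multiplication by a scalar; for \<^typ>\<open>complex\<close> this is the complex vector
  space structure.\<close>

lift_definition nmat_scale :: "'a::{real_normed_div_algebra, banach} \<Rightarrow> 'a nmat \<Rightarrow> 'a nmat" is
  "\<lambda>a A i j. a * A i j"
  by (rule Nn_carrier_lmult)

instantiation nmat :: ("{real_normed_div_algebra, banach}") real_normed_vector
begin

definition "norm X =
  (SUP (I, J)\<in>{(I, J). finite I \<and> finite J \<and> card I = card J}. fin_opnorm I J (nmat_entry X))"
definition "sgn X = X /\<^sub>R norm (X :: 'a nmat)"
definition "dist X Y = norm (X - Y :: 'a nmat)"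
definition
  "(uniformity :: ('a nmat \<times> 'a nmat) filter) = (INF e\<in>{0 <..}. principal {(x, y). dist x y < e})"
definition
  "open (U :: 'a nmat set) \<longleftrightarrow> (\<forall>x\<in>U. eventually (\<lambda>(x', y). x' = x \<longrightarrow> y \<in> U) uniformity)"

lemma norm_nmat_le:
  assumes "mat_bnd (nmat_entry X) c" shows "norm X \<le> c"
  unfolding norm_nmat_def
proof (rule cSUP_least)
  show "{(I, J). finite I \<and> finite J \<and> card I = card J} \<noteq> ({} :: (nat set \<times> nat set) set)"
    by (rule ex_in_conv[THEN iffD1, OF exI[of _ "({}, {})"]]) simp
qed (use assms in \<open>auto simp: mat_bnd_iff\<close>)

lemma mat_bnd_nmat: "mat_bnd (nmat_entry X) (norm X)"
proof -
  obtain c where c: "mat_bnd (nmat_entry X) c" using nmat_entry Nn_carrier_bnd by meson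
  have bdd: "bdd_above ((\<lambda>(I, J). fin_opnorm I J (nmat_entry X)) ` {(I, J). finite I \<and> finite J \<and> card I = card J})"
    by (rule bdd_aboveI2[where M = c]) (use c in \<open>auto simp: mat_bnd_iff\<close>)
  have le: "fin_opnorm {..p} {..p} (nmat_entry X) \<le> norm X" for p
    unfolding norm_nmat_def using cSUP_upper[OF _ bdd, of "({..p}, {..p})"] by simp
  show ?thesis
    using le[of 0] fin_opnorm_nonneg[of "{..0}" "{..0}" "nmat_entry X"]
    by (intro mat_bndI_blocks[of 0] le) auto
qed

instance
proof
  fix X Y :: "'a nmat" and r :: real
  show "sgn X = X /\<^sub>R norm X" by (simp add: sgn_nmat_def)
  show "dist X Y = norm (X - Y)" by (simp add: dist_nmat_def)
  show "(uniformity :: ('a nmat \<times> 'a nmat) filter) = (INF e\<in>{0 <..}. principal {(x, y). dist x y < e})"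
    by (simp add: uniformity_nmat_def)
  show "open U \<longleftrightarrow> (\<forall>x\<in>U. eventually (\<lambda>(x', y). x' = x \<longrightarrow> y \<in> U) uniformity)" for U :: "'a nmat set"
    by (simp add: open_nmat_def)
  have nn: "0 \<le> norm Z" for Z :: "'a nmat" using mat_bnd_nmat mat_bnd_nonneg by blast
  show "norm X = 0 \<longleftrightarrow> X = 0"
  proof
    assume "norm X = 0"
    then have "nmat_entry X i j = 0" for i j
      using mat_bnd_entry[OF mat_bnd_nmat[of X], of i j] by simp
    then show "X = 0" by (simp add: nmat_entry_inject[symmetric] zero_nmat.rep_eq fun_eq_iff)
  next
    assume "X = 0"
    then have "norm X \<le> 0" by (intro norm_nmat_le) (simp add: zero_nmat.rep_eq mat_bnd_zero)
    then show "norm X = 0" using nn[of X] by simp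
  qed
  show "norm (X + Y) \<le> norm X + norm Y"
    by (rule norm_nmat_le) (simp add: plus_nmat.rep_eq mat_bnd_add mat_bnd_nmat)
  have le: "norm (r *\<^sub>R Z) \<le> \<bar>r\<bar> * norm Z" for r and Z :: "'a nmat"
    using norm_nmat_le[of "r *\<^sub>R Z"] mat_bnd_lmult[OF mat_bnd_nmat[of Z], of "of_real r"]
    by (simp add: scaleR_nmat.rep_eq scaleR_conv_of_real)
  show "norm (r *\<^sub>R X) = \<bar>r\<bar> * norm X"
  proof (cases "r = 0")
    case True
    then show ?thesis using le[of 0 X] nn[of "0 *\<^sub>R X"] by simp
  next
    case False
    have "norm X \<le> \<bar>inverse r\<bar> * norm (r *\<^sub>R X)" using le[of "inverse r" "r *\<^sub>R X"] False by simp
    then have "\<bar>r\<bar> * norm X \<le> norm (r *\<^sub>R X)" using False by (simp add: field_simps)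
    then show ?thesis using le[of r X] by simp
  qed
qed

end

lift_definition nmat_trunc :: "'a::{real_normed_div_algebra, banach} nmat \<Rightarrow> nat \<Rightarrow> 'a nmat" is mat_block
proof -
  fix A :: "nat \<Rightarrow> nat \<Rightarrow> 'a" and n
  have "mat_tail (mat_block A n) n = (\<lambda>i j. 0)" by (auto simp: mat_tail_def mat_block_def fun_eq_iff)
  then show "mat_block A n \<in> Nn_carrier"
    unfolding Nn_carrier_iff by (metis mat_bnd_zero mat_bnd_mono less_imp_le)
qed

lemma nmat_trunc_tendsto: "nmat_trunc X \<longlonglongrightarrow> X"
proof (rule metric_LIMSEQ_I)
  fix r :: real assume "r > 0"
  then obtain n where n: "mat_bnd (mat_tail (nmat_entry X) n) (r/3)"
    using nmat_entry[of X] unfolding Nn_carrier_iff by (metis divide_pos_pos zero_less_numeral)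
  have "dist (nmat_trunc X m) X < r" if "m \<ge> n" for m
  proof -
    have "nmat_entry (X - nmat_trunc X m) = mat_tail (nmat_entry X) m"
      by (auto simp: minus_nmat.rep_eq nmat_trunc.rep_eq mat_tail_def mat_block_def fun_eq_iff)
    then have "norm (X - nmat_trunc X m) \<le> 2 * (r/3)"
      using norm_nmat_le mat_bnd_tail_mono[OF n that] by metis
    then show ?thesis using \<open>r > 0\<close> by (simp add: dist_norm norm_minus_commute)
  qed
  then show "\<exists>no. \<forall>m\<ge>no. dist (nmat_trunc X m) X < r" by blast
qed

instantiation nmat :: ("{real_normed_div_algebra, banach}") real_normed_algebra
begin

lift_definition times_nmat :: "'a nmat \<Rightarrow> 'a nmat \<Rightarrow> 'a nmat" is mat_mult
  by (rule Nn_carrier_mult)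

instance
proof
  show distr: "(X + Y) * Z = X * Z + Y * Z" for X Y Z :: "'a nmat"
    unfolding nmat_entry_inject[symmetric] times_nmat.rep_eq plus_nmat.rep_eq
    by (rule mat_mult_add_left[OF mat_bnd_nmat mat_bnd_nmat mat_bnd_nmat])
  show distl: "X * (Y + Z) = X * Y + X * Z" for X Y Z :: "'a nmat"
    unfolding nmat_entry_inject[symmetric] times_nmat.rep_eq plus_nmat.rep_eq
    by (rule mat_mult_add_right[OF mat_bnd_nmat mat_bnd_nmat mat_bnd_nmat])
  show scl: "(r *\<^sub>R X) * Y = r *\<^sub>R (X * Y)" for X Y :: "'a nmat" and r
    unfolding nmat_entry_inject[symmetric] times_nmat.rep_eq scaleR_nmat.rep_eq mat_mult_def
    by (simp add: suminf_scaleR_right[OF mat_mult_summable[OF mat_bnd_nmat mat_bnd_nmat]])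
  show scr: "X * (r *\<^sub>R Y) = r *\<^sub>R (X * Y)" for X Y :: "'a nmat" and r
    unfolding nmat_entry_inject[symmetric] times_nmat.rep_eq scaleR_nmat.rep_eq mat_mult_def
    by (simp add: suminf_scaleR_right[OF mat_mult_summable[OF mat_bnd_nmat mat_bnd_nmat]])
  show le: "norm (X * Y) \<le> norm X * norm Y" for X Y :: "'a nmat"
    by (rule norm_nmat_le) (simp add: times_nmat.rep_eq mat_bnd_mult mat_bnd_nmat)
  have bil: "bounded_bilinear ((*) :: 'a nmat \<Rightarrow> _)"
    by standard (use distr distl scl scr le in \<open>auto intro!: exI[of _ 1]\<close>)
  fix X Y Z :: "'a nmat"
  have "nmat_trunc X n * nmat_trunc Y n * nmat_trunc Z n = nmat_trunc X n * (nmat_trunc Y n * nmat_trunc Z n)" for n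
    unfolding nmat_entry_inject[symmetric] times_nmat.rep_eq nmat_trunc.rep_eq fun_eq_iff mat_mult_blocks
      sum_distrib_left sum_distrib_right
    by (subst sum.swap) (simp add: mult.assoc)
  moreover have "(\<lambda>n. nmat_trunc X n * nmat_trunc Y n * nmat_trunc Z n) \<longlonglongrightarrow> X * Y * Z"
    by (intro bounded_bilinear.tendsto[OF bil] nmat_trunc_tendsto)
  moreover have "(\<lambda>n. nmat_trunc X n * (nmat_trunc Y n * nmat_trunc Z n)) \<longlonglongrightarrow> X * (Y * Z)"
    by (intro bounded_bilinear.tendsto[OF bil] nmat_trunc_tendsto)
  ultimately show "X * Y * Z = X * (Y * Z)" using LIMSEQ_unique by simp
qed

end

section \<open>The algebra \<open>C(Q, \<N>\<^sub>n(F))\<close>\<close>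

text \<open>A continuous map on the space \<open>Q\<close> is represented by its extension by \<open>0\<close> outside
  \<^term>\<open>topspace Q\<close>, so that equality of maps is equality on \<^term>\<open>topspace Q\<close>. Addition and
  multiplication of maps are the pointwise ones of \<^theory>\<open>HOL-Library.Function_Algebras\<close>.\<close>

definition cmaps :: "'q topology \<Rightarrow> ('q \<Rightarrow> 'b::{topological_space, zero}) set" where
  "cmaps Q = {f. continuous_map Q euclidean f \<and> (\<forall>q. q \<notin> topspace Q \<longrightarrow> f q = 0)}"

definition cmap_scaleR :: "real \<Rightarrow> ('q \<Rightarrow> 'b::real_vector) \<Rightarrow> 'q \<Rightarrow> 'b" where
  "cmap_scaleR r f = (\<lambda>q. r *\<^sub>R f q)"

definition cmap_scaleC :: "complex \<Rightarrow> ('q \<Rightarrow> complex nmat) \<Rightarrow> 'q \<Rightarrow> complex nmat" where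
  "cmap_scaleC c f = (\<lambda>q. nmat_scale c (f q))"

lemma norm_nmat_scale_le: "norm (nmat_scale a X) \<le> norm a * norm X"
  by (rule norm_nmat_le) (simp add: nmat_scale.rep_eq mat_bnd_lmult mat_bnd_nmat)

lemma bounded_linear_nmat_scale: "bounded_linear (nmat_scale a)"
proof (rule bounded_linear_intro[where K = "norm a"])
  show "nmat_scale a (X + Y) = nmat_scale a X + nmat_scale a Y" for X Y
    by transfer (simp add: distrib_left)
  show "nmat_scale a (r *\<^sub>R X) = r *\<^sub>R nmat_scale a X" for r X
    by transfer simp
  show "norm (nmat_scale a X) \<le> norm X * norm a" for X
    using norm_nmat_scale_le[of a X] by (simp add: mult.commute)
qed

lemma continuous_map_binop:
  fixes f g :: "'q \<Rightarrow> 'b::topological_space" and h :: "'b \<times> 'b \<Rightarrow> 'c::topological_space"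
  assumes "continuous_map Q euclidean f" "continuous_map Q euclidean g" "continuous_on UNIV h"
  shows "continuous_map Q euclidean (\<lambda>q. h (f q, g q))"
proof -
  have "continuous_map Q (prod_topology euclidean euclidean) (\<lambda>q. (f q, g q))"
    using assms by (intro continuous_map_pairedI)
  moreover have "continuous_map (prod_topology euclidean euclidean) euclidean h"
    using assms(3) by simp
  ultimately show ?thesis using continuous_map_compose[unfolded o_def] by blast
qed

lemma cmaps_zero: "0 \<in> cmaps Q"
  by (simp add: cmaps_def zero_fun_def)

lemma cmaps_add:
  fixes f g :: "'q \<Rightarrow> 'b::real_normed_vector"
  assumes "f \<in> cmaps Q" "g \<in> cmaps Q" shows "f + g \<in> cmaps Q"
  using assms continuous_map_binop[of Q f g "\<lambda>(x, y). x + y"]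
  by (auto simp: cmaps_def plus_fun_def split_def intro!: continuous_intros)

lemma cmaps_mult:
  fixes f g :: "'q \<Rightarrow> 'b::real_normed_algebra"
  assumes "f \<in> cmaps Q" "g \<in> cmaps Q" shows "f * g \<in> cmaps Q"
proof -
  have "continuous_on UNIV (\<lambda>p :: 'b \<times> 'b. fst p * snd p)"
    by (intro bounded_bilinear.continuous_on[OF bounded_bilinear_mult] continuous_on_fst continuous_on_snd continuous_on_id)
  then show ?thesis
    using assms continuous_map_binop[of Q f g "\<lambda>p. fst p * snd p"] by (auto simp: cmaps_def times_fun_def)
qed

lemma cmaps_linear_image:
  assumes "f \<in> cmaps Q" "bounded_linear h" shows "(\<lambda>q. h (f q)) \<in> cmaps Q"
  using assms continuous_map_compose[of Q euclidean f euclidean h]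
  by (auto simp: cmaps_def o_def linear_simps intro: linear_continuous_on)

lemma cmaps_scaleR:
  fixes f :: "'q \<Rightarrow> 'b::real_normed_vector"
  assumes "f \<in> cmaps Q" shows "cmap_scaleR r f \<in> cmaps Q"
  unfolding cmap_scaleR_def by (rule cmaps_linear_image[OF assms bounded_linear_scaleR_right])

lemma cmaps_scaleC: "f \<in> cmaps Q \<Longrightarrow> cmap_scaleC c f \<in> cmaps Q"
  unfolding cmap_scaleC_def by (rule cmaps_linear_image[OF _ bounded_linear_nmat_scale])

section \<open>Derivations and 2-local derivations\<close>

text \<open>\<open>A\<close> is the carrier of the algebra and \<open>s\<close> its scalar multiplication; the values of the maps
  outside \<open>A\<close> are irrelevant.\<close>

definition derivation_on :: "('k \<Rightarrow> 'x::ring \<Rightarrow> 'x) \<Rightarrow> 'x set \<Rightarrow> ('x \<Rightarrow> 'x) \<Rightarrow> bool" where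
  "derivation_on s A D \<longleftrightarrow> D \<in> A \<rightarrow> A \<and>
     (\<forall>x\<in>A. \<forall>y\<in>A. D (x + y) = D x + D y) \<and>
     (\<forall>c. \<forall>x\<in>A. D (s c x) = s c (D x)) \<and>
     (\<forall>x\<in>A. \<forall>y\<in>A. D (x * y) = D x * y + x * D y)"

definition two_local_derivation_on :: "('k \<Rightarrow> 'x::ring \<Rightarrow> 'x) \<Rightarrow> 'x set \<Rightarrow> ('x \<Rightarrow> 'x) \<Rightarrow> bool" where
  "two_local_derivation_on s A \<Delta> \<longleftrightarrow> \<Delta> \<in> A \<rightarrow> A \<and>
     (\<forall>x\<in>A. \<forall>y\<in>A. \<exists>D. derivation_on s A D \<and> \<Delta> x = D x \<and> \<Delta> y = D y)"

end

theory Submission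
  imports Defs
begin

text \<open>
  Fix \<open>F\<close> and let \<open>\<rho>\<close> be the real part on \<open>F\<close>. It is a trace: \<open>\<rho> (x * y) = \<rho> (y * x)\<close>. Two ideas
  carry the proof, one for additivity of \<open>\<Delta>\<close> and one for the product rule. Throughout, algebras are
  taken over the reals; a complex derivation is in particular a real one, and homogeneity of a 2-local
  derivation is immediate, since some derivation agrees with it at both \<open>x\<close> and \<open>c x\<close>.

  Additivity. For finite matrices a derivation \<open>D\<close> kills the trace, so
  \<open>tr (D x * z) = - tr (x * D z)\<close>. If \<open>D\<close> agrees with \<open>\<Delta>\<close> at \<open>x\<close> and \<open>z\<close>, then
  \<open>tr (\<Delta> x * z) = - tr (x * \<Delta> z)\<close>, and the right-hand side is additive in \<open>x\<close>, whence so is \<open>\<Delta>\<close>. For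
  infinite matrices it is enough to let \<open>z = c e\<^sub>i\<^sub>j\<close> be constant. Then \<open>D z\<close> lives on one row and one
  column, all traces involved are single entries of products, and the identity (\<open>trace_identity\<close>) comes
  from expanding \<open>D (z * x * z)\<close>, where \<open>z * x * z\<close> is a multiple of \<open>e\<^sub>i\<^sub>j\<close> by a continuous
  function. The only analytic fact about derivations is that \<open>\<rho>\<close> vanishes on the values of a derivation of the algebra of
  continuous functions with values in \<open>F\<close> (\<open>scalar_derivation_traceless\<close>): a function vanishing at \<open>q\<close> is a
  product of two such functions, so a derivation only sees the value at \<open>q\<close>, and on \<open>F\<close> itself a
  derivation maps into the traceless elements, because every element of \<open>F\<close> is a root of a real quadratic
  polynomial.

  Product rule. Zero products are respected: if \<open>a * b = 0\<close>, then \<open>\<Delta> a * b + a * \<Delta> b = 0\<close>. For an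
  idempotent \<open>e\<close> this applies to \<open>(a - a * e) * e = 0\<close> and, given additivity, yields the product rule for
  \<open>a * e\<close> (\<open>idempotent_right_factor\<close>). The elements \<open>t\<close> for which the product rule holds for all
  \<open>a * t\<close> form a ring, and this ring contains every matrix supported on a single column, because such
  matrices are built from idempotents by sums, differences and products. Comparing \<open>\<Delta> ((x * y) * e\<^sub>k\<^sub>k)\<close> with
  \<open>\<Delta> (x * (y * e\<^sub>k\<^sub>k))\<close> then gives the product rule for \<open>x * y\<close> in every column \<open>k\<close>.
\<close>

section \<open>Additive 2-local derivations and idempotents\<close>

locale additive_two_local =
  fixes s :: "'k \<Rightarrow> 'x::ring \<Rightarrow> 'x" and A :: "'x set" and \<Delta> :: "'x \<Rightarrow> 'x"
  assumes two_local: "two_local_derivation_on s A \<Delta>"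
    and diff_closed: "\<And>x y. x \<in> A \<Longrightarrow> y \<in> A \<Longrightarrow> x - y \<in> A"
    and mult_closed: "\<And>x y. x \<in> A \<Longrightarrow> y \<in> A \<Longrightarrow> x * y \<in> A"
    and \<Delta>_diff: "\<And>x y. x \<in> A \<Longrightarrow> y \<in> A \<Longrightarrow> \<Delta> (x - y) = \<Delta> x - \<Delta> y"
begin

lemma zero_product:
  assumes "a \<in> A" "b \<in> A" "a * b = 0"
  shows "\<Delta> a * b + a * \<Delta> b = 0"
proof -
  obtain D where D: "derivation_on s A D" "\<Delta> a = D a" "\<Delta> b = D b"
    using two_local assms(1,2) unfolding two_local_derivation_on_def by blast
  have "0 \<in> A" using diff_closed[OF assms(1,1)] by simp
  then have "D (0 + 0) = D 0 + D 0" using D(1) unfolding derivation_on_def by blast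
  then have "D (a * b) = 0" using assms(3) by simp
  then show ?thesis using D assms(1,2) unfolding derivation_on_def by simp
qed

text \<open>Membership of \<open>t\<close> asks for the product rule of \<open>a * t\<close> with \<open>a\<close> arbitrary. This one-sided form is
  what makes the set closed under products.\<close>

definition right_factors :: "'x set" where
  "right_factors = {t \<in> A. \<forall>a\<in>A. \<Delta> (a * t) = \<Delta> a * t + a * \<Delta> t}"

lemma right_factorsD:
  "t \<in> right_factors \<Longrightarrow> a \<in> A \<Longrightarrow> \<Delta> (a * t) = \<Delta> a * t + a * \<Delta> t"
  by (simp add: right_factors_def)

text \<open>The zero product \<open>(a - a * e) * e\<close> shows that \<open>\<Delta> a * e + a * \<Delta> e\<close> does not change when \<open>a\<close> is
  replaced by \<open>a * e\<close>. For the latter it is \<open>\<Delta> (a * e)\<close>: a derivation that agrees with \<open>\<Delta>\<close> at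
  \<open>a * e\<close> and \<open>e\<close> can be applied to \<open>a * e = (a * e) * e\<close>.\<close>

lemma idempotent_right_factor:
  assumes e: "e \<in> A" "e * e = e"
  shows "e \<in> right_factors"
  unfolding right_factors_def
proof (intro CollectI conjI ballI e(1))
  fix a assume a: "a \<in> A"
  have ae: "a * e \<in> A" using a e by (simp add: mult_closed)
  have aee: "a * e * e = a * e" using e(2) by (simp add: mult.assoc)
  obtain D where D: "derivation_on s A D" "\<Delta> (a * e) = D (a * e)" "\<Delta> e = D e"
    using two_local ae e(1) unfolding two_local_derivation_on_def by blast
  have "D (a * e * e) = D (a * e) * e + a * e * D e"
    using D(1) ae e(1) unfolding derivation_on_def by blast
  then have 1: "\<Delta> (a * e) = \<Delta> (a * e) * e + a * e * \<Delta> e" using D aee by simp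
  have "\<Delta> (a - a * e) * e + (a - a * e) * \<Delta> e = 0"
    using a ae e aee by (intro zero_product diff_closed) (simp_all add: left_diff_distrib)
  then have "\<Delta> a * e + a * \<Delta> e = \<Delta> (a * e) * e + a * e * \<Delta> e"
    using a ae by (simp add: \<Delta>_diff algebra_simps)
  then show "\<Delta> (a * e) = \<Delta> a * e + a * \<Delta> e" using 1 by simp
qed

lemma right_factors_diff:
  assumes t: "t \<in> right_factors" and u: "u \<in> right_factors"
  shows "t - u \<in> right_factors"
proof -
  have A: "t \<in> A" "u \<in> A" using t u by (simp_all add: right_factors_def)
  then show ?thesis
    unfolding right_factors_def
    by (auto simp: diff_closed mult_closed \<Delta>_diff right_diff_distrib right_factorsD[OF t]
        right_factorsD[OF u] algebra_simps)
qed

lemma right_factors_add: "t \<in> right_factors \<Longrightarrow> u \<in> right_factors \<Longrightarrow> t + u \<in> right_factors"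
  using right_factors_diff[of t "(u - u) - u"] right_factors_diff[of u u] right_factors_diff[of "u - u" u]
  by simp

lemma right_factors_mult:
  assumes t: "t \<in> right_factors" and u: "u \<in> right_factors"
  shows "t * u \<in> right_factors"
proof -
  have A: "t \<in> A" "u \<in> A" using t u by (simp_all add: right_factors_def)
  have "\<Delta> (a * (t * u)) = \<Delta> a * (t * u) + a * \<Delta> (t * u)" if "a \<in> A" for a
    using right_factorsD[OF u, of "a * t"] right_factorsD[OF u A(1)] right_factorsD[OF t that] that A
    by (simp add: mult_closed algebra_simps)
  then show ?thesis using A unfolding right_factors_def by (simp add: mult_closed)
qed

text \<open>The two bracketings of \<open>x * y * e\<close> are expanded by different right factors: \<open>e\<close> in the first case,
  \<open>y * e\<close> and then \<open>e\<close> in the second.\<close>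

lemma product_rule_times:
  assumes "x \<in> A" "y \<in> A" "e \<in> right_factors" "y * e \<in> right_factors"
  shows "(\<Delta> (x * y) - (\<Delta> x * y + x * \<Delta> y)) * e = 0"
proof -
  have "\<Delta> (x * y * e) = \<Delta> (x * y) * e + x * y * \<Delta> e"
    using right_factorsD[OF assms(3)] assms(1,2) mult_closed by blast
  moreover have "\<Delta> (x * (y * e)) = \<Delta> x * (y * e) + x * \<Delta> (y * e)"
    using right_factorsD[OF assms(4,1)] .
  moreover have "\<Delta> (y * e) = \<Delta> y * e + y * \<Delta> e"
    using right_factorsD[OF assms(3,2)] .
  ultimately show ?thesis by (simp add: algebra_simps)
qed

end

section \<open>Matrix units with continuous coefficients\<close>

lemma mat_bnd_single: "mat_bnd (mat_single i j (c :: 'a::real_normed_div_algebra)) (norm c)"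
  unfolding mat_bnd_def
proof (intro conjI allI impI)
  fix I J :: "nat set" and x :: "nat \<Rightarrow> 'a" assume f: "finite I" "finite J"
  have row: "(\<Sum>l\<in>J. mat_single i j c k l * x l) = (if k = i then if j \<in> J then c * x j else 0 else 0)" for k
  proof -
    have "(\<Sum>l\<in>J. mat_single i j c k l * x l) = (\<Sum>l\<in>J. if l = j then if k = i then c * x j else 0 else 0)"
      by (intro sum.cong) (auto simp: mat_single_def)
    then show ?thesis using f by (simp add: sum.delta)
  qed
  have "L2_set (\<lambda>k. norm (\<Sum>l\<in>J. mat_single i j c k l * x l)) I
      \<le> (\<Sum>k\<in>I. norm (\<Sum>l\<in>J. mat_single i j c k l * x l))"
    by (rule L2_set_le_sum) auto
  also have "\<dots> = (\<Sum>k\<in>I. if k = i then norm (if j \<in> J then c * x j else 0) else 0)"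
    unfolding row by (intro sum.cong) auto
  also have "\<dots> \<le> (if j \<in> J then norm c * norm (x j) else 0)"
    using f by (simp add: sum.delta norm_mult)
  also have "\<dots> \<le> norm c * L2_set (\<lambda>l. norm (x l)) J"
    using f by (auto intro!: mult_left_mono member_le_L2_set)
  finally show "L2_set (\<lambda>k. norm (\<Sum>l\<in>J. mat_single i j c k l * x l)) I
      \<le> norm c * L2_set (\<lambda>l. norm (x l)) J" .
qed simp

lift_definition nmat_unit :: "nat \<Rightarrow> nat \<Rightarrow> 'a::{real_normed_div_algebra, banach} \<Rightarrow> 'a nmat" is mat_single
proof -
  fix i j :: nat and c :: 'a
  have "mat_tail (mat_single i j c) (Suc (max i j)) = (\<lambda>i j. 0)"
    by (auto simp: mat_tail_def mat_single_def fun_eq_iff)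
  then show "mat_single i j c \<in> Nn_carrier"
    unfolding Nn_carrier_iff by (metis mat_bnd_zero mat_bnd_mono less_imp_le)
qed

lemma nmat_eqI: "(\<And>i j. nmat_entry X i j = nmat_entry Y i j) \<Longrightarrow> X = Y"
  by (simp add: nmat_entry_inject[symmetric] fun_eq_iff)

lemma nmat_entry_arith [simp]:
  "nmat_entry 0 i j = 0"
  "nmat_entry (X + Y) i j = nmat_entry X i j + nmat_entry Y i j"
  "nmat_entry (X - Y) i j = nmat_entry X i j - nmat_entry Y i j"
  "nmat_entry (r *\<^sub>R X) i j = r *\<^sub>R nmat_entry X i j"
  by (simp_all add: zero_nmat.rep_eq plus_nmat.rep_eq minus_nmat.rep_eq scaleR_nmat.rep_eq)

lemma nmat_entry_unit: "nmat_entry (nmat_unit i j c) k l = (if k = i \<and> l = j then c else 0)"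
  by (simp add: nmat_unit.rep_eq mat_single_def)

lemma nmat_entry_unit_mult [simp]:
  "nmat_entry (nmat_unit i j c * X) k l = (if k = i then c * nmat_entry X j l else 0)"
proof -
  have "nmat_entry (nmat_unit i j c * X) k l = (\<Sum>\<xi>\<in>{j}. nmat_entry (nmat_unit i j c) k \<xi> * nmat_entry X \<xi> l)"
    unfolding times_nmat.rep_eq mat_mult_def by (rule suminf_finite) (auto simp: nmat_entry_unit)
  then show ?thesis by (simp add: nmat_entry_unit)
qed

lemma nmat_entry_mult_unit [simp]:
  "nmat_entry (X * nmat_unit i j c) k l = (if l = j then nmat_entry X k i * c else 0)"
proof -
  have "nmat_entry (X * nmat_unit i j c) k l = (\<Sum>\<xi>\<in>{i}. nmat_entry X k \<xi> * nmat_entry (nmat_unit i j c) \<xi> l)"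
    unfolding times_nmat.rep_eq mat_mult_def by (rule suminf_finite) (auto simp: nmat_entry_unit)
  then show ?thesis by (simp add: nmat_entry_unit)
qed

lemma nmat_unit_mult_unit:
  "nmat_unit i j c * nmat_unit k l d = (if j = k then nmat_unit i l (c * d) else 0)"
  by (rule nmat_eqI) (auto simp: nmat_entry_unit)

lemma bounded_linear_nmat_unit: "bounded_linear (nmat_unit i j)"
proof (rule bounded_linear_intro[where K = 1])
  show "norm (nmat_unit i j c) \<le> norm c * 1" for c :: 'a
    using norm_nmat_le[of "nmat_unit i j c" "norm c"] by (simp add: nmat_unit.rep_eq mat_bnd_single)
qed (auto intro!: nmat_eqI simp: nmat_entry_unit)

lemma bounded_linear_nmat_entry: "bounded_linear (\<lambda>X. nmat_entry X i j)"
  by (rule bounded_linear_intro[where K = 1]) (simp_all add: mat_bnd_entry[OF mat_bnd_nmat])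

lemma cmaps_diff:
  fixes f g :: "'q \<Rightarrow> 'b::real_normed_vector"
  assumes "f \<in> cmaps Q" "g \<in> cmaps Q" shows "f - g \<in> cmaps Q"
proof -
  have eq: "f - g = f + cmap_scaleR (-1) g" by (simp add: fun_eq_iff cmap_scaleR_def)
  show ?thesis unfolding eq by (intro cmaps_add cmaps_scaleR assms)
qed

text \<open>In these names the prefix \<open>c\<close> stands for continuous: the coefficients are elements of
  \<^term>\<open>cmaps Q\<close> with scalar values. Constants therefore have to be cut off outside
  \<^term>\<open>topspace Q\<close>, and \<^term>\<open>cconst Q 1\<close> is the unit of this scalar algebra.\<close>

definition cunit :: "nat \<Rightarrow> nat \<Rightarrow> ('q \<Rightarrow> 'a) \<Rightarrow> 'q \<Rightarrow> 'a::{real_normed_div_algebra, banach} nmat" where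
  "cunit i j \<phi> = (\<lambda>q. nmat_unit i j (\<phi> q))"

definition centry :: "('q \<Rightarrow> 'a::{real_normed_div_algebra, banach} nmat) \<Rightarrow> nat \<Rightarrow> nat \<Rightarrow> 'q \<Rightarrow> 'a" where
  "centry f i j = (\<lambda>q. nmat_entry (f q) i j)"

definition cconst :: "'q topology \<Rightarrow> 'a \<Rightarrow> 'q \<Rightarrow> 'a::zero" where
  "cconst Q c = (\<lambda>q. if q \<in> topspace Q then c else 0)"

lemma cunit_in_cmaps: "\<phi> \<in> cmaps Q \<Longrightarrow> cunit i j \<phi> \<in> cmaps Q"
  unfolding cunit_def by (rule cmaps_linear_image[OF _ bounded_linear_nmat_unit])

lemma centry_in_cmaps: "f \<in> cmaps Q \<Longrightarrow> centry f i j \<in> cmaps Q"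
  unfolding centry_def by (rule cmaps_linear_image[OF _ bounded_linear_nmat_entry])

lemma cconst_in_cmaps: "cconst Q c \<in> cmaps Q"
proof -
  have "continuous_map Q euclidean (cconst Q c)"
    by (rule continuous_map_eq[of Q euclidean "\<lambda>_. c"]) (simp_all add: cconst_def)
  then show ?thesis by (simp add: cmaps_def cconst_def)
qed

section \<open>Derivations of the algebra of continuous scalar functions\<close>

lemma derivation_onD:
  assumes "derivation_on s A D" "x \<in> A" "y \<in> A"
  shows "D x \<in> A" "D (x + y) = D x + D y" "D (x * y) = D x * y + x * D y" "D (s c x) = s c (D x)"
  using assms unfolding derivation_on_def by auto

text \<open>At \<open>0\<close> the formula takes the value \<open>0\<close>, and its norm is \<open>sqrt (norm x)\<close> everywhere.\<close>

lemma continuous_on_div_sqrt_norm: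
  "continuous_on UNIV (\<lambda>x :: 'a::real_normed_vector. x /\<^sub>R sqrt (norm x))"
proof (rule continuous_at_imp_continuous_on, rule ballI)
  fix x :: 'a
  show "isCont (\<lambda>x. x /\<^sub>R sqrt (norm x)) x"
  proof (cases "x = 0")
    case False
    then show ?thesis by (intro continuous_intros) auto
  next
    case True
    have "isCont (\<lambda>y :: 'a. sqrt (norm y)) 0" by (intro continuous_intros)
    then have "((\<lambda>y :: 'a. sqrt (norm y)) \<longlongrightarrow> 0) (at 0)" by (simp add: isCont_def)
    moreover have "norm (y /\<^sub>R sqrt (norm y)) = sqrt (norm y)" for y :: 'a
      by (cases "y = 0") (simp_all add: field_simps)
    ultimately have "((\<lambda>y :: 'a. norm (y /\<^sub>R sqrt (norm y))) \<longlongrightarrow> 0) (at 0)" by simp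
    then have "((\<lambda>y :: 'a. y /\<^sub>R sqrt (norm y)) \<longlongrightarrow> 0) (at 0)" by (rule tendsto_norm_zero_cancel)
    then show ?thesis using True by (simp add: isCont_def)
  qed
qed

lemma cmaps_compose:
  assumes "f \<in> cmaps Q" "continuous_on UNIV h" "h 0 = 0"
  shows "(\<lambda>q. h (f q)) \<in> cmaps Q"
  using assms continuous_map_compose[of Q euclidean f euclidean h]
  by (auto simp: cmaps_def o_def)

text \<open>A continuous \<open>\<phi>\<close> is the product of \<open>\<phi> / sqrt (norm \<phi>)\<close> and \<open>sqrt (norm \<phi>)\<close>, and both factors
  vanish wherever \<open>\<phi>\<close> does. The product rule then gives \<open>0\<close> at such points.\<close>

lemma scalar_derivation_vanishes:
  fixes \<delta> :: "('q \<Rightarrow> 'a::real_normed_div_algebra) \<Rightarrow> 'q \<Rightarrow> 'a"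
  assumes \<delta>: "derivation_on cmap_scaleR (cmaps Q) \<delta>" and \<phi>: "\<phi> \<in> cmaps Q" and q: "\<phi> q = 0"
  shows "\<delta> \<phi> q = 0"
proof -
  define \<alpha> where "\<alpha> = (\<lambda>p. \<phi> p /\<^sub>R sqrt (norm (\<phi> p)))"
  define \<beta> where "\<beta> = (\<lambda>p. of_real (sqrt (norm (\<phi> p))) :: 'a)"
  have \<alpha>: "\<alpha> \<in> cmaps Q"
    unfolding \<alpha>_def by (rule cmaps_compose[OF \<phi> continuous_on_div_sqrt_norm]) simp
  have \<beta>: "\<beta> \<in> cmaps Q"
    unfolding \<beta>_def by (rule cmaps_compose[OF \<phi>, of "\<lambda>x. of_real (sqrt (norm x))"]) (intro continuous_intros, simp)
  have "\<phi> = \<alpha> * \<beta>"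
  proof
    show "\<phi> p = (\<alpha> * \<beta>) p" for p
      by (cases "\<phi> p = 0") (simp_all add: \<alpha>_def \<beta>_def of_real_def)
  qed
  then have "\<delta> \<phi> = \<delta> \<alpha> * \<beta> + \<alpha> * \<delta> \<beta>" using derivation_onD(3)[OF \<delta> \<alpha> \<beta>] by simp
  then show ?thesis using q by (simp add: \<alpha>_def \<beta>_def)
qed

text \<open>The properties of the real part that the reals, the complex numbers and the quaternions share. By
  the last one, each traceless element squares to a real number.\<close>

locale quadratic_trace =
  fixes \<rho> :: "'a::{real_normed_div_algebra, banach} \<Rightarrow> real"
  assumes linear: "linear \<rho>"
    and commute: "\<rho> (x * y) = \<rho> (y * x)"
    and one: "\<rho> 1 = 1"
    and quadratic: "(x - of_real (\<rho> x)) * (x - of_real (\<rho> x)) \<in> \<real>"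
begin

text \<open>Up to a function vanishing at \<open>q\<close>, the function \<open>\<phi>\<close> is constant, so \<open>\<delta>\<close> at \<open>q\<close> comes from a
  derivation \<open>d\<close> of the scalars. It kills the reals, so \<open>\<phi> q\<close> may be replaced by its traceless part \<open>v\<close>.
  As \<open>v * v = r\<close> is real, \<open>d v * v + v * d v = 0\<close>; multiplying by \<open>v\<close> and taking traces gives
  \<open>2 r \<rho> (d v) = 0\<close>, and \<open>r\<close> is nonzero unless \<open>v\<close> is, as there are no zero divisors.\<close>

lemma scalar_derivation_traceless:
  assumes \<delta>: "derivation_on cmap_scaleR (cmaps Q) (\<delta> :: ('q \<Rightarrow> 'a) \<Rightarrow> 'q \<Rightarrow> 'a)" and \<phi>: "\<phi> \<in> cmaps Q"
  shows "\<rho> (\<delta> \<phi> q) = 0"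
proof (cases "q \<in> topspace Q")
  case False
  then have "\<delta> \<phi> q = 0" using derivation_onD(1)[OF \<delta> \<phi> \<phi>] by (simp add: cmaps_def)
  then show ?thesis using linear_0[OF linear] by simp
next
  case True
  let ?c = "cconst Q :: 'a \<Rightarrow> _"
  have local: "\<delta> \<psi> q = \<delta> (?c (\<psi> q)) q" if "\<psi> \<in> cmaps Q" for \<psi>
  proof -
    have "\<delta> ((\<psi> - ?c (\<psi> q)) + ?c (\<psi> q)) = \<delta> (\<psi> - ?c (\<psi> q)) + \<delta> (?c (\<psi> q))"
      by (intro derivation_onD(2)[OF \<delta>] cmaps_diff that cconst_in_cmaps)
    moreover have "\<delta> (\<psi> - ?c (\<psi> q)) q = 0"
      by (rule scalar_derivation_vanishes[OF \<delta>])
         (use True in \<open>simp_all add: cmaps_diff that cconst_in_cmaps, simp add: cconst_def\<close>)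
    ultimately show ?thesis by simp
  qed
  define d where "d c = \<delta> (?c c) q" for c
  have c_add: "?c (x + y) = ?c x + ?c y" for x y by (auto simp: cconst_def fun_eq_iff)
  have c_mult: "?c (x * y) = ?c x * ?c y" for x y by (auto simp: cconst_def fun_eq_iff)
  have c_scale: "?c (r *\<^sub>R x) = cmap_scaleR r (?c x)" for r x
    by (auto simp: cconst_def cmap_scaleR_def fun_eq_iff)
  note \<delta>c = derivation_onD[OF \<delta> cconst_in_cmaps cconst_in_cmaps]
  have cq: "?c x q = x" for x using True by (simp add: cconst_def)
  have d_add: "d (x + y) = d x + d y" for x y by (simp add: d_def c_add \<delta>c(2))
  have d_mult: "d (x * y) = d x * y + x * d y" for x y by (simp add: d_def c_mult \<delta>c(3) cq)
  have d_scale: "d (r *\<^sub>R x) = r *\<^sub>R d x" for r x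
    by (simp add: d_def c_scale \<delta>c(4)) (simp add: cmap_scaleR_def)
  have "d 1 = 0" using d_mult[of 1 1] by simp
  then have d_real: "d (of_real r) = 0" for r using d_scale[of r 1] by (simp add: of_real_def)
  define v where "v = \<phi> q - of_real (\<rho> (\<phi> q))"
  have dv: "d (\<phi> q) = d v" using d_add[of v "of_real (\<rho> (\<phi> q))"] by (simp add: v_def d_real)
  obtain r where r: "v * v = of_real r" using quadratic[of "\<phi> q"] unfolding v_def by (auto elim: Reals_cases)
  have "\<rho> (d v) = 0"
  proof (cases "v = 0")
    case True
    then show ?thesis using d_real[of 0] linear_0[OF linear] by simp
  next
    case False
    then have "r \<noteq> 0" using r by auto
    have "d v * v + v * d v = 0" using d_mult[of v v] by (simp add: r d_real)
    then have "0 = \<rho> (v * (d v * v + v * d v))" using linear_0[OF linear] by simp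
    also have "\<dots> = \<rho> (v * (d v * v)) + \<rho> (v * (v * d v))"
      by (simp add: distrib_left linear_add[OF linear])
    also have "\<rho> (v * (d v * v)) = \<rho> (v * v * d v)" using commute[of "v * d v" v] by (simp add: mult.assoc)
    also have "v * (v * d v) = v * v * d v" by (simp add: mult.assoc)
    also have "v * v * d v = r *\<^sub>R d v" by (simp add: r scaleR_conv_of_real)
    finally show ?thesis using \<open>r \<noteq> 0\<close> by (simp add: linear_scale[OF linear])
  qed
  then show ?thesis using local[OF \<phi>] dv by (simp add: d_def)
qed

lemma nondegenerate:
  assumes "\<And>c. c \<noteq> 0 \<Longrightarrow> \<rho> (x * c) = \<rho> (y * c)"
  shows "x = y"
proof (rule ccontr)
  assume "x \<noteq> y"
  then have "\<rho> ((x - y) * inverse (x - y)) = 0"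
    using assms[of "inverse (x - y)"] by (simp add: left_diff_distrib linear_diff[OF linear])
  then show False using \<open>x \<noteq> y\<close> by (simp add: one)
qed

section \<open>The trace identity\<close>

text \<open>Compressing a derivation by the idempotent \<open>e\<^sub>i\<^sub>i\<close> gives a derivation of the corner
  \<open>e\<^sub>i\<^sub>i A e\<^sub>i\<^sub>i\<close>, which is a copy of the algebra of continuous scalar functions.\<close>

lemma corner_traceless:
  assumes D: "derivation_on cmap_scaleR (cmaps Q) (D :: ('q \<Rightarrow> 'a nmat) \<Rightarrow> _)" and \<phi>: "\<phi> \<in> cmaps Q"
  shows "\<rho> (nmat_entry (D (cunit i i \<phi>) q) i i) = 0"
proof -
  define \<delta> where "\<delta> \<psi> = centry (D (cunit i i \<psi>)) i i" for \<psi>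
  have "derivation_on cmap_scaleR (cmaps Q) \<delta>"
    unfolding derivation_on_def
  proof (intro conjI ballI allI funcsetI)
    fix \<psi> \<eta> :: "'q \<Rightarrow> 'a" and r :: real assume m: "\<psi> \<in> cmaps Q" "\<eta> \<in> cmaps Q"
    note u = cunit_in_cmaps[OF m(1), of i i] cunit_in_cmaps[OF m(2), of i i]
    note D' = derivation_onD[OF D u]
    show "\<delta> \<psi> \<in> cmaps Q" unfolding \<delta>_def by (rule centry_in_cmaps[OF D'(1)])
    have add: "cunit i i (\<psi> + \<eta>) = cunit i i \<psi> + cunit i i \<eta>"
      by (auto simp: cunit_def fun_eq_iff linear_simps[OF bounded_linear_nmat_unit])
    show "\<delta> (\<psi> + \<eta>) = \<delta> \<psi> + \<delta> \<eta>"
      unfolding \<delta>_def add D'(2) by (simp add: centry_def fun_eq_iff)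
    have scale: "cunit i i (cmap_scaleR r \<psi>) = cmap_scaleR r (cunit i i \<psi>)"
      by (auto simp: cunit_def cmap_scaleR_def fun_eq_iff linear_simps[OF bounded_linear_nmat_unit])
    show "\<delta> (cmap_scaleR r \<psi>) = cmap_scaleR r (\<delta> \<psi>)"
      unfolding \<delta>_def scale D'(4) by (simp add: centry_def cmap_scaleR_def fun_eq_iff)
    have mult: "cunit i i (\<psi> * \<eta>) = cunit i i \<psi> * cunit i i \<eta>"
      by (auto simp: cunit_def fun_eq_iff nmat_unit_mult_unit)
    show "\<delta> (\<psi> * \<eta>) = \<delta> \<psi> * \<eta> + \<psi> * \<delta> \<eta>"
      unfolding \<delta>_def mult D'(3) by (simp add: centry_def cunit_def fun_eq_iff)
  qed
  from scalar_derivation_traceless[OF this \<phi>, of q] show ?thesis by (simp add: \<delta>_def centry_def)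
qed

text \<open>The identity \<open>tr (D x * z) = - tr (x * D z)\<close> for \<open>z = c e\<^sub>i\<^sub>j\<close>. The matrix \<open>D z\<close> is supported on
  row \<open>i\<close> and column \<open>j\<close>; the last two terms collect their contributions to \<open>tr (x * D z)\<close>, and the
  first one corrects for the entry \<open>(i, j)\<close>, which is counted in both. The point of the formula is that
  its right-hand side is additive in \<open>x\<close> and depends on \<open>D\<close> only through \<open>D z\<close>.\<close>

lemma trace_identity:
  fixes x :: "'q \<Rightarrow> 'a nmat" and i j :: nat
  assumes D: "derivation_on cmap_scaleR (cmaps Q) D" and x: "x \<in> cmaps Q"
    and q: "q \<in> topspace Q" and c: "c \<noteq> 0"
  defines "z \<equiv> cunit i j (cconst Q c)"
  shows "\<rho> (nmat_entry (D x q) j i * c) = \<rho> (nmat_entry (D z q) i j * nmat_entry (x q) j i)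
    - \<rho> (nmat_entry (D z q * x q) i i) - \<rho> (nmat_entry (x q * D z q) j j)"
proof -
  have z: "z \<in> cmaps Q" unfolding z_def by (intro cunit_in_cmaps cconst_in_cmaps)
  have zq: "z q = nmat_unit i j c" using q by (simp add: z_def cunit_def cconst_def)
  define \<phi> where "\<phi> = cconst Q c * centry x j i"
  have \<phi>: "\<phi> \<in> cmaps Q" unfolding \<phi>_def by (intro cmaps_mult cconst_in_cmaps centry_in_cmaps x)
  have \<phi>q: "\<phi> q = c * nmat_entry (x q) j i" using q by (simp add: \<phi>_def cconst_def centry_def)
  have zxz: "z * x * z = cunit i i \<phi> * z"
    by (auto simp: z_def cunit_def \<phi>_def centry_def fun_eq_iff nmat_entry_unit intro!: nmat_eqI)
  \<comment> \<open>Two expansions of \<open>D (z * x * z)\<close>: along its three factors, and along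
    \<open>\<phi> e\<^sub>i\<^sub>i * z\<close>, whose first factor contributes a traceless corner entry.\<close>
  have "D (z * x * z) = (D z * x + z * D x) * z + z * x * D z"
    using derivation_onD(3)[OF D cmaps_mult[OF z x] z] derivation_onD(3)[OF D z x] by simp
  moreover have "D (z * x * z) = D (cunit i i \<phi>) * z + cunit i i \<phi> * D z"
    unfolding zxz by (rule derivation_onD(3)[OF D cunit_in_cmaps[OF \<phi>] z])
  ultimately have "D z q * x q * z q + z q * D x q * z q + z q * (x q * D z q)
      = D (cunit i i \<phi>) q * z q + cunit i i \<phi> q * D z q"
    by (simp add: fun_eq_iff distrib_right mult.assoc)
  then have "nmat_entry (D z q * x q * z q + z q * D x q * z q + z q * (x q * D z q)) i j
      = nmat_entry (D (cunit i i \<phi>) q * z q + cunit i i \<phi> q * D z q) i j" by simp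
  then have eq: "nmat_entry (D z q * x q) i i * c + c * nmat_entry (D x q) j i * c
        + c * nmat_entry (x q * D z q) j j
      = nmat_entry (D (cunit i i \<phi>) q) i i * c + c * nmat_entry (x q) j i * nmat_entry (D z q) i j"
    by (simp add: zq \<phi>q cunit_def)
  have conj: "\<rho> (inverse c * (y * c)) = \<rho> y" for y
    using commute[of "inverse c" "y * c"] c by (simp add: mult.assoc)
  have canc: "inverse c * (c * y) = y" for y using c by (simp add: mult.assoc[symmetric])
  have "\<rho> (inverse c * (nmat_entry (D z q * x q) i i * c + c * nmat_entry (D x q) j i * c
        + c * nmat_entry (x q * D z q) j j))
    = \<rho> (inverse c * (nmat_entry (D (cunit i i \<phi>) q) i i * c + c * nmat_entry (x q) j i * nmat_entry (D z q) i j))"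
    by (simp only: eq)
  then have "\<rho> (nmat_entry (D z q * x q) i i) + \<rho> (nmat_entry (D x q) j i * c) + \<rho> (nmat_entry (x q * D z q) j j)
    = \<rho> (nmat_entry (D (cunit i i \<phi>) q) i i) + \<rho> (nmat_entry (x q) j i * nmat_entry (D z q) i j)"
    by (simp add: distrib_left linear_add[OF linear] conj canc mult.assoc)
  then show ?thesis
    using corner_traceless[OF D \<phi>, of i q] commute[of "nmat_entry (x q) j i"] by simp
qed

lemma two_local_additive:
  fixes \<Delta> :: "('q \<Rightarrow> 'a nmat) \<Rightarrow> 'q \<Rightarrow> 'a nmat"
  assumes \<Delta>: "two_local_derivation_on cmap_scaleR (cmaps Q) \<Delta>" and x: "x \<in> cmaps Q" and y: "y \<in> cmaps Q"
  shows "\<Delta> (x + y) = \<Delta> x + \<Delta> y"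
proof (rule ext)
  fix q
  have in_cmaps: "\<Delta> u \<in> cmaps Q" if "u \<in> cmaps Q" for u
    using \<Delta> that unfolding two_local_derivation_on_def by blast
  show "\<Delta> (x + y) q = (\<Delta> x + \<Delta> y) q"
  proof (cases "q \<in> topspace Q")
    case False
    then show ?thesis
      using in_cmaps[OF x] in_cmaps[OF y] in_cmaps[OF cmaps_add[OF x y]] by (simp add: cmaps_def)
  next
    case True
    have "nmat_entry (\<Delta> (x + y) q) j i = nmat_entry (\<Delta> x q + \<Delta> y q) j i" for i j
    proof (rule nondegenerate)
      fix c :: 'a assume c: "c \<noteq> 0"
      define z where "z = cunit i j (cconst Q c)"
      have z: "z \<in> cmaps Q" unfolding z_def by (intro cunit_in_cmaps cconst_in_cmaps)
      have *: "\<rho> (nmat_entry (\<Delta> u q) j i * c) = \<rho> (nmat_entry (\<Delta> z q) i j * nmat_entry (u q) j i)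
          - \<rho> (nmat_entry (\<Delta> z q * u q) i i) - \<rho> (nmat_entry (u q * \<Delta> z q) j j)"
        if u: "u \<in> cmaps Q" for u
      proof -
        obtain D where "derivation_on cmap_scaleR (cmaps Q) D" "\<Delta> u = D u" "\<Delta> z = D z"
          using \<Delta> u z unfolding two_local_derivation_on_def by blast
        then show ?thesis using trace_identity[where i = i and j = j and c = c] u True c unfolding z_def by metis
      qed
      show "\<rho> (nmat_entry (\<Delta> (x + y) q) j i * c) = \<rho> (nmat_entry (\<Delta> x q + \<Delta> y q) j i * c)"
        using *[OF x] *[OF y] *[OF cmaps_add[OF x y]]
        by (simp add: distrib_left distrib_right linear_add[OF linear])
    qed
    then show ?thesis by (auto intro: nmat_eqI)
  qed
qed

section \<open>The product rule\<close>

theorem two_local_derivation: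
  fixes \<Delta> :: "('q \<Rightarrow> 'a nmat) \<Rightarrow> 'q \<Rightarrow> 'a nmat"
  assumes \<Delta>: "two_local_derivation_on cmap_scaleR (cmaps Q) \<Delta>"
  shows "derivation_on cmap_scaleR (cmaps Q) \<Delta>"
proof -
  have in_cmaps: "\<Delta> u \<in> cmaps Q" if "u \<in> cmaps Q" for u
    using \<Delta> that unfolding two_local_derivation_on_def by blast
  have scale: "\<Delta> (cmap_scaleR r x) = cmap_scaleR r (\<Delta> x)" if x: "x \<in> cmaps Q" for r x
  proof -
    obtain D where "derivation_on cmap_scaleR (cmaps Q) D" "\<Delta> x = D x"
        "\<Delta> (cmap_scaleR r x) = D (cmap_scaleR r x)"
      using \<Delta> x cmaps_scaleR[OF x, of r] unfolding two_local_derivation_on_def by blast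
    then show ?thesis using derivation_onD(4)[OF _ x x] by simp
  qed
  interpret additive_two_local cmap_scaleR "cmaps Q" \<Delta>
  proof
    show "\<Delta> (x - y) = \<Delta> x - \<Delta> y" if "x \<in> cmaps Q" "y \<in> cmaps Q" for x y
      using two_local_additive[OF \<Delta> cmaps_diff[OF that] that(2)] by simp
  qed (use \<Delta> in \<open>auto intro: cmaps_diff cmaps_mult\<close>)
  let ?one = "cconst Q 1 :: 'q \<Rightarrow> 'a"
  have one_mult: "\<phi> * ?one = \<phi>" "?one * \<phi> = \<phi>" if "\<phi> \<in> cmaps Q" for \<phi>
    using that by (auto simp: fun_eq_iff cconst_def cmaps_def)
  let ?e = "\<lambda>k. cunit k k ?one"
  have e: "?e k \<in> cmaps Q" "?e k * ?e k = ?e k" for k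
    by (auto simp: cunit_in_cmaps cconst_in_cmaps) (auto simp: cunit_def cconst_def fun_eq_iff nmat_unit_mult_unit)
  note e_factor = idempotent_right_factor[OF e]
  \<comment> \<open>A matrix \<open>u\<close> in column \<open>k\<close> whose diagonal entry is zero squares to zero, and
    \<open>e\<^sub>k\<^sub>k + u\<close> is idempotent.\<close>
  have column: "u \<in> right_factors" if u: "u \<in> cmaps Q" "u * ?e k = u" "?e k * u = 0" for u k
  proof -
    have "u * u = u * (?e k * u)" using u(2) by (metis mult.assoc)
    then have "(?e k + u) * (?e k + u) = ?e k + u" using u e by (simp add: distrib_left distrib_right)
    then have "(?e k + u) - ?e k \<in> right_factors"
      by (intro right_factors_diff e_factor idempotent_right_factor cmaps_add e u)
    then show ?thesis by simp
  qed
  have off_diagonal: "cunit k l \<phi> \<in> right_factors" if "\<phi> \<in> cmaps Q" "k \<noteq> l" for k l \<phi>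
    by (rule column[of _ l])
       (use that in \<open>auto simp: cunit_in_cmaps\<close>, auto simp: cunit_def fun_eq_iff nmat_unit_mult_unit cconst_def cmaps_def)
  \<comment> \<open>Diagonal entries are reached as products of two off-diagonal units; \<open>Suc k\<close> serves as an
    index different from \<open>k\<close>.\<close>
  have diagonal: "cunit k k \<phi> \<in> right_factors" if "\<phi> \<in> cmaps Q" for k \<phi>
  proof -
    have "cunit k (Suc k) \<phi> * cunit (Suc k) k ?one = cunit k k (\<phi> * ?one)"
      by (simp add: cunit_def fun_eq_iff nmat_unit_mult_unit)
    then show ?thesis
      using right_factors_mult[OF off_diagonal[of \<phi> k "Suc k"] off_diagonal[of ?one "Suc k" k]] that
      by (simp add: cconst_in_cmaps one_mult)
  qed
  have ye: "y * ?e k \<in> right_factors" if y: "y \<in> cmaps Q" for y k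
  proof -
    have corner: "?e k * y * ?e k = cunit k k (centry y k k)"
      using y by (auto simp: cunit_def fun_eq_iff cconst_def centry_def cmaps_def nmat_entry_unit intro!: nmat_eqI)
    have "y * ?e k - ?e k * y * ?e k \<in> right_factors"
    proof (rule column[of _ k])
      show "(y * ?e k - ?e k * y * ?e k) * ?e k = y * ?e k - ?e k * y * ?e k"
        by (simp add: left_diff_distrib mult.assoc e)
      show "?e k * (y * ?e k - ?e k * y * ?e k) = 0"
        by (simp add: right_diff_distrib mult.assoc[symmetric] e)
    qed (intro cmaps_diff cmaps_mult e y)
    moreover have "?e k * y * ?e k \<in> right_factors"
      unfolding corner by (intro diagonal centry_in_cmaps y)
    ultimately show ?thesis
      using right_factors_add[of "y * ?e k - ?e k * y * ?e k" "?e k * y * ?e k"] by simp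
  qed
  have prod: "\<Delta> (x * y) = \<Delta> x * y + x * \<Delta> y" if xy: "x \<in> cmaps Q" "y \<in> cmaps Q" for x y
  proof (rule ext)
    fix q
    define w where "w = \<Delta> (x * y) - (\<Delta> x * y + x * \<Delta> y)"
    have w: "w \<in> cmaps Q" unfolding w_def by (intro cmaps_diff cmaps_add cmaps_mult in_cmaps xy)
    have "w * ?e k = 0" for k
      unfolding w_def by (rule product_rule_times[OF xy e_factor ye[OF xy(2)]])
    then have "nmat_entry ((w * ?e k) q) i k = 0" for i k by simp
    then have "nmat_entry (w q) i k = 0" for i k
      using w by (cases "q \<in> topspace Q") (auto simp: cunit_def cconst_def cmaps_def)
    then have "w q = 0" by (auto intro: nmat_eqI)
    then show "\<Delta> (x * y) q = (\<Delta> x * y + x * \<Delta> y) q" by (simp add: w_def)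
  qed
  show ?thesis
    unfolding derivation_on_def using in_cmaps two_local_additive[OF \<Delta>] scale prod by blast
qed

end

section \<open>The three scalar fields\<close>

lemma quadratic_trace_real: "quadratic_trace (\<lambda>x :: real. x)"
  by standard (auto simp: mult.commute)

lemma quadratic_trace_complex: "quadratic_trace Re"
proof
  show "(x - of_real (Re x)) * (x - of_real (Re x)) \<in> \<real>" for x
    by (simp add: complex_is_Real_iff)
qed (auto simp: mult.commute)

lemma quadratic_trace_quat: "quadratic_trace qre"
proof
  fix x y :: quat
  show "qre (x * y) = qre (y * x)" by (simp add: times_quat_def)
  have "(x - of_real (qre x)) * (x - of_real (qre x)) = of_real (- ((qi x)\<^sup>2 + (qj x)\<^sup>2 + (qk x)\<^sup>2))"
    by (simp add: quat_eq_iff of_real_def times_quat_def power2_eq_square)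
  then show "(x - of_real (qre x)) * (x - of_real (qre x)) \<in> \<real>" by (metis Reals_of_real)
qed auto

lemma cmap_scaleC_of_real: "cmap_scaleC (of_real r) f = cmap_scaleR r f"
  by (auto simp: cmap_scaleC_def cmap_scaleR_def fun_eq_iff nmat_scale.rep_eq scaleR_conv_of_real intro!: nmat_eqI)

lemma complex_two_local_derivation:
  assumes \<Delta>: "two_local_derivation_on cmap_scaleC (cmaps Q) \<Delta>"
  shows "derivation_on cmap_scaleC (cmaps Q) \<Delta>"
proof -
  have real: "derivation_on cmap_scaleR A D" if "derivation_on cmap_scaleC A D" for A and D :: "('q \<Rightarrow> complex nmat) \<Rightarrow> _"
    using that unfolding derivation_on_def by (metis cmap_scaleC_of_real)
  then have "two_local_derivation_on cmap_scaleR (cmaps Q) \<Delta>"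
    using \<Delta> unfolding two_local_derivation_on_def by meson
  then have "derivation_on cmap_scaleR (cmaps Q) \<Delta>"
    by (rule quadratic_trace.two_local_derivation[OF quadratic_trace_complex])
  moreover have "\<Delta> (cmap_scaleC c x) = cmap_scaleC c (\<Delta> x)" if x: "x \<in> cmaps Q" for c x
  proof -
    obtain D where "derivation_on cmap_scaleC (cmaps Q) D" "\<Delta> x = D x"
        "\<Delta> (cmap_scaleC c x) = D (cmap_scaleC c x)"
      using \<Delta> x cmaps_scaleC[OF x, of c] unfolding two_local_derivation_on_def by blast
    then show ?thesis using derivation_onD(4)[OF _ x x] by simp
  qed
  ultimately show ?thesis unfolding derivation_on_def by blast
qed

theorem theorem3:
  fixes Q :: "'q topology"
    and \<Delta>C :: "('q \<Rightarrow> complex nmat) \<Rightarrow> 'q \<Rightarrow> complex nmat"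
    and \<Delta>R :: "('q \<Rightarrow> real nmat) \<Rightarrow> 'q \<Rightarrow> real nmat"
    and \<Delta>H :: "('q \<Rightarrow> quat nmat) \<Rightarrow> 'q \<Rightarrow> quat nmat"
  assumes "compact_space Q" and "Hausdorff_space Q"
  shows "(two_local_derivation_on cmap_scaleC (cmaps Q) \<Delta>C \<longrightarrow>
            derivation_on cmap_scaleC (cmaps Q) \<Delta>C) \<and>
         (two_local_derivation_on cmap_scaleR (cmaps Q) \<Delta>R \<longrightarrow>
            derivation_on cmap_scaleR (cmaps Q) \<Delta>R) \<and>
         (two_local_derivation_on cmap_scaleR (cmaps Q) \<Delta>H \<longrightarrow>
            derivation_on cmap_scaleR (cmaps Q) \<Delta>H)"
  using complex_two_local_derivation[of Q \<Delta>C]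
    quadratic_trace.two_local_derivation[OF quadratic_trace_real, of Q \<Delta>R]
    quadratic_trace.two_local_derivation[OF quadratic_trace_quat, of Q \<Delta>H]
  by blast

end
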